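(* Let $0<\alpha<2$, $\lambda\in\mathbb{R}$, $\Sigma=\{x\in\mathbb{R}^n : x_1<\lambda\}$, and let $x^\lambda=(2\lambda-x_1,x_2,\dots,x_n)$ denote the reflection of $x$ about the plane $\{x_1=\lambda\}$. Let $\Omega$ be a bounded domain in $\Sigma$. Assume that $w\in L_\alpha\cap C^{1,1}_{loc}(\Omega)$ and that $w$ is lower semi-continuous on $\bar\Omega$. Suppose $$ \begin{cases} (-\Delta)^{\alpha/2}w(x)\ge 0 & \text{for } x\in\Omega,\\ w(x)\ge 0 & \text{for } x\in\Sigma\setminus\Omega,\\ w(x^\lambda)=-w(x) & \text{for } x\in\Sigma. \end{cases} $$ Then $w(x)\ge 0$ in $\Omega$. Furthermore, if $w=0$ at some point in $\Omega$, then $w(x)=0$ for almost every $x\in\mathbb{R}^n$. These conclusions also hold for an unbounded region $\Omega\subset\Sigma$ if one further assumes that $\liminf_{|x|\to\infty}w(x)\ge 0$.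
   Context: $L_\alpha=\{u:\mathbb{R}^n\to\mathbb{R} : \int_{\mathbb{R}^n}\frac{|u(x)|}{1+|x|^{n+\alpha}}\,dx<\infty\}$. $C^{1,1}_{loc}(\Omega)$ denotes functions that are (on $\Omega$) differentiable with locally Lipschitz gradient. For $0<\alpha<2$, $u\in L_\alpha$ and $x$ in an open set where $u$ is $C^{1,1}_{loc}$, the fractional Laplacian is defined pointwise by $$(-\Delta)^{\alpha/2}u(x)=C_{n,\alpha}\lim_{\epsilon\to0}\int_{\mathbb{R}^n\setminus B_\epsilon(x)}\frac{u(x)-u(z)}{|x-z|^{n+\alpha}}\,dz,$$ where $C_{n,\alpha}>0$ is a normalization constant. *)

theory Defs
  imports "HOL-Analysis.Analysis"
begin

text \<open>The weighted space \<open>L\<^sub>\<alpha>\<close>. Measurability is listed separately because integrability of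
  \<open>\<bar>u\<bar>\<close> alone does not yield it.\<close>

definition L_space :: "real \<Rightarrow> (real ^ 'n \<Rightarrow> real) set" where
  "L_space \<alpha> = {u. u \<in> borel_measurable lebesgue \<and>
     integrable lebesgue (\<lambda>x. \<bar>u x\<bar> / (1 + norm x powr (real CARD('n) + \<alpha>)))}"

definition C11_loc :: "('a::euclidean_space) set \<Rightarrow> ('a \<Rightarrow> real) set" where
  "C11_loc \<Omega> = {u. \<exists>g. (\<forall>x\<in>\<Omega>. GDERIV u x :> g x) \<and>
     (\<forall>x\<in>\<Omega>. \<exists>r>0. \<exists>L. L-lipschitz_on (cball x r \<inter> \<Omega>) g)}"

definition lower_semicontinuous_on :: "('a::topological_space) set \<Rightarrow> ('a \<Rightarrow> real) \<Rightarrow> bool" where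
  "lower_semicontinuous_on S f \<longleftrightarrow> (\<forall>x\<in>S. \<forall>a<f x. \<forall>\<^sub>F y in at x within S. a < f y)"

text \<open>The fractional Laplacian \<open>(-\<Delta>)\<^bsup>\<alpha>/2\<^esup> u x\<close> as a principal value, with normalization
  constant \<open>C\<close>. \<open>Lim\<close> is a total operator, so the value is meaningful only where the limit
  exists, e.g. for \<open>u\<close> in \<open>L_space \<alpha>\<close> at points of an open set on which \<open>u\<close> is \<open>C11_loc\<close>.\<close>

definition frac_laplacian :: "real \<Rightarrow> real \<Rightarrow> (real ^ 'n \<Rightarrow> real) \<Rightarrow> real ^ 'n \<Rightarrow> real" where
  "frac_laplacian C \<alpha> u x =
     C * Lim (at_right 0) (\<lambda>\<epsilon>. LINT z:(UNIV - ball x \<epsilon>)|lebesgue.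
           (u x - u z) / norm (x - z) powr (real CARD('n) + \<alpha>))"

text \<open>The coordinate called \<open>x\<^sub>1\<close> on paper is an arbitrary but fixed index \<open>k\<close>, as the finite index
  type \<open>'n\<close> has no distinguished first element.\<close>

definition left_halfspace :: "'n \<Rightarrow> real \<Rightarrow> (real ^ 'n) set" where
  "left_halfspace k \<mu> = {x. x $ k < \<mu>}"

definition reflect :: "'n \<Rightarrow> real \<Rightarrow> real ^ 'n \<Rightarrow> real ^ 'n" where
  "reflect k \<mu> x = (\<chi> i. if i = k then 2 * \<mu> - x $ k else x $ i)"

end

theory Submission
  imports Defs
begin

text \<open>
  Fold the principal value at \<open>x\<close> onto \<open>\<Sigma>\<close>: by antisymmetry, and up to a term that vanishes as
  \<open>\<epsilon> \<rightarrow> 0\<close>, it is the integral over \<open>\<Sigma> - B\<^sub>\<epsilon>(x)\<close> of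
  \<open>(w x - w z) (K - K') + 2 w x K'\<close>, where \<open>K = \<bar>x - z\<bar>\<^bsup>-p\<^esup>\<close>, \<open>K' = \<bar>x - z\<^sup>\<lambda>\<bar>\<^bsup>-p\<^esup>\<close>,
  \<open>p = n + \<alpha>\<close> and \<open>0 < K' < K\<close>.

  Let \<open>-m = inf w < 0\<close> over \<open>\<Sigma>\<close>; this is finite, but it might only be approached at the boundary
  hyperplane, where \<open>w\<close> is uncontrolled. Therefore take a point \<open>y\<close> with
  \<open>w y < -m + \<theta> m\<close>, let \<open>2 \<rho>\<close> be its distance to the hyperplane, and minimise
  \<open>w z + \<theta> m \<bar>z - y\<bar>\<^sup>2 / \<rho>\<^sup>2\<close>. The minimum is attained at some \<open>x \<in> \<Omega>\<close> in the ball of radius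
  \<open>\<rho>\<close> about \<open>y\<close>, and there the paraboloid bounds the first summand by a multiple of
  \<open>\<theta> m \<rho>\<^bsup>-\<alpha>\<^esup>\<close>, whereas the second contributes at most a fixed negative multiple of
  \<open>m \<rho>\<^bsup>-\<alpha>\<^esup>\<close>. All constants are scale invariant, so a small \<open>\<theta>\<close> makes the fractional
  Laplacian negative at \<open>x\<close>.

  If \<open>w \<ge> 0\<close> and \<open>w x = 0\<close>, the folded integrand is \<open>-w z (K - K') \<le> 0\<close>, so nonnegativity of its
  integral forces \<open>w = 0\<close> almost everywhere.
\<close>

subsection \<open>Integrals of powers of the distance\<close>

text \<open>On the shell the power exceeds \<open>R powr s\<close> by at most the factor
  \<open>2 powr \<bar>s\<bar>\<close>, whatever the sign of \<open>s\<close>, and the shell lies in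
  a ball of radius \<open>2 * R\<close>.\<close>

lemma nn_integral_norm_powr_shell:
  fixes x :: "'a::euclidean_space" and s :: real
  assumes R: "0 < R"
  shows "(\<integral>\<^sup>+z. ennreal (norm (x - z) powr s) *
            indicator {z. R \<le> norm (x - z) \<and> norm (x - z) < 2 * R} z \<partial>lebesgue)
    \<le> ennreal (unit_ball_vol (real DIM('a)) * 2 powr (DIM('a) + \<bar>s\<bar>) * R powr (DIM('a) + s))"
proof -
  let ?n = "real DIM('a)"
  have pw: "norm (x - z) powr s \<le> 2 powr \<bar>s\<bar> * R powr s"
    if "R \<le> norm (x - z)" "norm (x - z) < 2 * R" for z
  proof (cases "0 \<le> s")
    case True
    have "norm (x - z) powr s \<le> (2 * R) powr s"
      using that True by (intro powr_mono2) auto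
    then show ?thesis using True R by (simp add: powr_mult)
  next
    case False
    have "norm (x - z) powr s \<le> R powr s"
      using that False R by (intro powr_mono2') auto
    also have "\<dots> \<le> 2 powr \<bar>s\<bar> * R powr s"
      using ge_one_powr_ge_zero[of 2 "\<bar>s\<bar>"] mult_right_mono[of 1 "2 powr \<bar>s\<bar>" "R powr s"] by auto
    finally show ?thesis .
  qed
  have "(\<integral>\<^sup>+z. ennreal (norm (x - z) powr s) *
            indicator {z. R \<le> norm (x - z) \<and> norm (x - z) < 2 * R} z \<partial>lebesgue)
    \<le> (\<integral>\<^sup>+z. ennreal (2 powr \<bar>s\<bar> * R powr s) * indicator (ball x (2 * R)) z \<partial>lebesgue)"
    using pw by (intro nn_integral_mono) (auto split: split_indicator simp: dist_norm ennreal_leI)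
  also have "\<dots> = ennreal (2 powr \<bar>s\<bar> * R powr s) * emeasure lebesgue (ball x (2 * R))"
    by (subst nn_integral_cmult) (auto intro: borel_measurable_indicator)
  also have "emeasure lebesgue (ball x (2 * R)) = ennreal (unit_ball_vol ?n * (2 * R) ^ DIM('a))"
    using emeasure_ball[of "2 * R" x] R by simp
  also have "ennreal (2 powr \<bar>s\<bar> * R powr s) * \<dots>
      = ennreal (2 powr \<bar>s\<bar> * R powr s * (unit_ball_vol ?n * (2 * R) ^ DIM('a)))"
    using R by (subst ennreal_mult) auto
  also have "2 powr \<bar>s\<bar> * R powr s * (unit_ball_vol ?n * (2 * R) ^ DIM('a))
      = unit_ball_vol ?n * 2 powr (?n + \<bar>s\<bar>) * R powr (?n + s)"
    using R by (simp add: powr_add powr_realpow power_mult_distrib mult_ac)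
  finally show ?thesis by simp
qed

text \<open>Summing the shell bound over the radii \<open>R * \<theta> ^ i\<close> gives a geometric
  series of ratio \<open>\<theta> powr (n + s)\<close>, where \<open>n\<close> is the dimension.
  Taking \<open>\<theta> = 1/2\<close> exhausts a ball inwards, and \<open>\<theta> = 2\<close>
  exhausts the complement of a ball outwards.\<close>

lemma nn_integral_norm_powr_shells:
  fixes x :: "'a::euclidean_space" and s :: real
  assumes R: "0 < R" and \<theta>: "0 < \<theta>" "\<theta> powr (DIM('a) + s) < 1"
    and A: "\<And>z. z \<in> A \<Longrightarrow> z \<noteq> x \<Longrightarrow> \<exists>i. R * \<theta> ^ i \<le> norm (x - z) \<and> norm (x - z) < 2 * (R * \<theta> ^ i)"
  shows "(\<integral>\<^sup>+z. ennreal (norm (x - z) powr s) * indicator A z \<partial>lebesgue)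
    \<le> ennreal (unit_ball_vol (real DIM('a)) * 2 powr (DIM('a) + \<bar>s\<bar>) / (1 - \<theta> powr (DIM('a) + s))
        * R powr (DIM('a) + s))"
proof -
  let ?S = "\<lambda>i. {z. R * \<theta> ^ i \<le> norm (x - z) \<and> norm (x - z) < 2 * (R * \<theta> ^ i)}"
  let ?c = "unit_ball_vol (real DIM('a)) * 2 powr (DIM('a) + \<bar>s\<bar>)" and ?q = "\<theta> powr (DIM('a) + s)"
  have S: "?S i \<in> sets lebesgue" for i
  proof -
    have "?S i = ball x (2 * (R * \<theta> ^ i)) - ball x (R * \<theta> ^ i)"
      by (auto simp: dist_norm)
    then show ?thesis by simp
  qed
  have mf: "(\<lambda>z. norm (x - z) powr s) \<in> borel_measurable lebesgue"
    by (rule measurable_completion) measurable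
  have "(\<integral>\<^sup>+z. ennreal (norm (x - z) powr s) * indicator A z \<partial>lebesgue)
     \<le> (\<integral>\<^sup>+z. (\<Sum>i. ennreal (norm (x - z) powr s) * indicator (?S i) z) \<partial>lebesgue)"
  proof (rule nn_integral_mono)
    fix z
    show "ennreal (norm (x - z) powr s) * indicator A z
        \<le> (\<Sum>i. ennreal (norm (x - z) powr s) * indicator (?S i) z)"
    \<comment> \<open>The centre lies in no shell, but there the integrand is
      \<open>0 powr s = 0\<close>.\<close>
    proof (cases "z \<in> A \<and> z \<noteq> x")
      case True
      then obtain i where i: "z \<in> ?S i" using A by blast
      have "ennreal (norm (x - z) powr s) * indicator A z
          = (\<Sum>j\<in>{i}. ennreal (norm (x - z) powr s) * indicator (?S j) z)"
        using True i by simp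
      also have "\<dots> \<le> (\<Sum>j. ennreal (norm (x - z) powr s) * indicator (?S j) z)"
        by (rule sum_le_suminf) auto
      finally show ?thesis .
    qed auto
  qed
  also have "\<dots> = (\<Sum>i. \<integral>\<^sup>+z. ennreal (norm (x - z) powr s) * indicator (?S i) z \<partial>lebesgue)"
    using S mf by (intro nn_integral_suminf borel_measurable_times_ennreal borel_measurable_indicator) auto
  also have "\<dots> \<le> (\<Sum>i. ennreal (?c * (R * \<theta> ^ i) powr (DIM('a) + s)))"
    using R \<theta> by (intro suminf_le nn_integral_norm_powr_shell) auto
  also have "(\<lambda>i. ?c * (R * \<theta> ^ i) powr (DIM('a) + s)) = (\<lambda>i. ?c * R powr (DIM('a) + s) * ?q ^ i)"
  proof
    fix i
    have "(\<theta> ^ i) powr (DIM('a) + s) = ?q ^ i"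
      using \<theta> by (simp add: powr_realpow[symmetric] powr_powr mult.commute)
    then show "?c * (R * \<theta> ^ i) powr (DIM('a) + s) = ?c * R powr (DIM('a) + s) * ?q ^ i"
      using R \<theta> by (simp add: powr_mult)
  qed
  also have "(\<Sum>i. ennreal (?c * R powr (DIM('a) + s) * ?q ^ i))
      = ennreal (?c * R powr (DIM('a) + s) * (1 / (1 - ?q)))"
    using \<theta> R by (intro suminf_ennreal_eq sums_mult geometric_sums) auto
  finally show ?thesis by (simp add: mult_ac)
qed

lemma set_integrable_norm_powr_shells:
  fixes x :: "'a::euclidean_space" and s :: real
  assumes R: "0 < R" and \<theta>: "0 < \<theta>" "\<theta> powr (DIM('a) + s) < 1"
    and A: "\<And>z. z \<in> A \<Longrightarrow> z \<noteq> x \<Longrightarrow> \<exists>i. R * \<theta> ^ i \<le> norm (x - z) \<and> norm (x - z) < 2 * (R * \<theta> ^ i)"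
    and mA: "A \<in> sets lebesgue"
  shows "set_integrable lebesgue A (\<lambda>z. norm (x - z) powr s)" (is ?th1)
    and "(LINT z:A|lebesgue. norm (x - z) powr s)
      \<le> unit_ball_vol (real DIM('a)) * 2 powr (DIM('a) + \<bar>s\<bar>) / (1 - \<theta> powr (DIM('a) + s))
          * R powr (DIM('a) + s)" (is "_ \<le> ?B")
proof -
  have mf: "(\<lambda>z. norm (x - z) powr s) \<in> borel_measurable lebesgue"
    by (rule measurable_completion) measurable
  have eq: "ennreal (indicator A z *\<^sub>R norm (x - z) powr s)
      = ennreal (norm (x - z) powr s) * indicator A z" for z
    by (auto split: split_indicator)
  have le: "(\<integral>\<^sup>+z. ennreal (indicator A z *\<^sub>R norm (x - z) powr s) \<partial>lebesgue) \<le> ennreal ?B"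
    unfolding eq by (rule nn_integral_norm_powr_shells[OF R \<theta> A])
  then show i: ?th1
    unfolding set_integrable_def
    using mf mA by (intro integrableI_nonneg) (auto simp: le_less_trans)
  have B: "0 \<le> ?B" using \<theta> R by auto
  show "(LINT z:A|lebesgue. norm (x - z) powr s) \<le> ?B"
    unfolding set_lebesgue_integral_def
    using le nn_integral_eq_integral[OF i[unfolded set_integrable_def]] B
    by (auto simp: ennreal_le_iff)
qed

text \<open>The radii halve, and \<open>s > - n\<close> is exactly what makes the ratio
  \<open>(1/2) powr (n + s)\<close> less than 1. The constant \<open>C\<close> is the same for all
  centres and radii; the scale invariance of the later estimates rests on this.\<close>

lemma integral_norm_powr_ball:
  fixes s :: real
  assumes s: "- real DIM('a) < s"
  obtains C where "0 \<le> C" and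
    "\<And>(x::'a::euclidean_space) \<rho>. 0 < \<rho> \<Longrightarrow> set_integrable lebesgue (ball x \<rho>) (\<lambda>z. norm (x - z) powr s)" and
    "\<And>(x::'a) \<rho>. 0 < \<rho> \<Longrightarrow> (LINT z:ball x \<rho>|lebesgue. norm (x - z) powr s) \<le> C * \<rho> powr (DIM('a) + s)"
proof -
  define c where "c = unit_ball_vol (real DIM('a)) * 2 powr (DIM('a) + \<bar>s\<bar>) / (1 - (1/2) powr (DIM('a) + s))"
  have q: "(1/2::real) powr (DIM('a) + s) < 1"
    using s powr_less_mono2[of "DIM('a) + s" "1/2" 1] by simp
  have cover: "\<exists>i. \<rho> / 2 * (1/2) ^ i \<le> norm (x - z) \<and> norm (x - z) < 2 * (\<rho> / 2 * (1/2) ^ i)"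
    if "z \<in> ball x \<rho>" "z \<noteq> x" for x z :: 'a and \<rho>
  proof -
    let ?P = "\<lambda>i. \<rho> / 2 * (1/2) ^ i \<le> norm (x - z)"
    have t: "norm (x - z) < \<rho>" using that by (simp add: dist_norm)
    then have \<rho>: "0 < \<rho>" using norm_ge_zero[of "x - z"] by linarith
    have "0 < norm (x - z) / \<rho>" using that \<rho> by simp
    then obtain j where "(1/2::real) ^ j < norm (x - z) / \<rho>"
      using real_arch_pow_inv[of "norm (x - z) / \<rho>" "1/2"] by auto
    then have "(1/2) ^ j * \<rho> < norm (x - z)" using \<rho> by (simp add: field_simps)
    then have "?P j" using mult_pos_pos[OF \<rho> zero_less_power[of "1/2" j]] by (simp add: mult.commute)
    \<comment> \<open>The least index whose inner radius does not exceed the distance: minimality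
      then gives the outer bound, since the previous inner radius is the present outer one.\<close>
    then have P: "?P (LEAST i. ?P i)" by (rule LeastI)
    show ?thesis
    proof (cases "LEAST i. ?P i")
      case 0
      then show ?thesis using P t by (intro exI[of _ 0]) auto
    next
      case (Suc i)
      then have "\<not> ?P i" using not_less_Least[of i ?P] by simp
      then show ?thesis using P Suc by (intro exI[of _ "Suc i"]) auto
    qed
  qed
  show thesis
  proof (rule that)
    show "0 \<le> c * (1/2) powr (DIM('a) + s)" using q by (auto simp: c_def)
    fix x :: 'a and \<rho> :: real assume \<rho>: "0 < \<rho>"
    show "set_integrable lebesgue (ball x \<rho>) (\<lambda>z. norm (x - z) powr s)"
      by (rule set_integrable_norm_powr_shells(1)[where R = "\<rho> / 2", OF _ _ q])
         (erule (1) cover | simp add: \<rho>)+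
    have "(LINT z:ball x \<rho>|lebesgue. norm (x - z) powr s) \<le> c * (\<rho> / 2) powr (DIM('a) + s)"
      unfolding c_def
      by (rule set_integrable_norm_powr_shells(2)[where R = "\<rho> / 2", OF _ _ q])
         (erule (1) cover | simp add: \<rho>)+
    also have "(\<rho> / 2) powr (DIM('a) + s) = (1/2) powr (DIM('a) + s) * \<rho> powr (DIM('a) + s)"
      using \<rho> powr_mult[of "1/2" \<rho> "DIM('a) + s"] by simp
    finally show "(LINT z:ball x \<rho>|lebesgue. norm (x - z) powr s)
        \<le> c * (1/2) powr (DIM('a) + s) * \<rho> powr (DIM('a) + s)" by simp
  qed
qed

text \<open>The counterpart at infinity: the radii double, and \<open>s < - n\<close> makes the
  ratio \<open>2 powr (n + s)\<close> less than 1.\<close>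

lemma integral_norm_powr_outside_ball:
  fixes s :: real
  assumes s: "s < - real DIM('a)"
  obtains C where "0 \<le> C" and
    "\<And>(x::'a::euclidean_space) \<rho>. 0 < \<rho> \<Longrightarrow> set_integrable lebesgue (- ball x \<rho>) (\<lambda>z. norm (x - z) powr s)" and
    "\<And>(x::'a) \<rho>. 0 < \<rho> \<Longrightarrow> (LINT z:- ball x \<rho>|lebesgue. norm (x - z) powr s) \<le> C * \<rho> powr (DIM('a) + s)"
proof -
  define c where "c = unit_ball_vol (real DIM('a)) * 2 powr (DIM('a) + \<bar>s\<bar>) / (1 - 2 powr (DIM('a) + s))"
  have q: "2 powr (DIM('a) + s) < 1"
    using s powr_less_mono[of "DIM('a) + s" 0 2] by simp
  have cover: "\<exists>i. \<rho> * 2 ^ i \<le> norm (x - z) \<and> norm (x - z) < 2 * (\<rho> * 2 ^ i)"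
    if "0 < \<rho>" "z \<in> - ball x \<rho>" for x z :: 'a and \<rho>
  proof -
    let ?P = "\<lambda>i. norm (x - z) < 2 * (\<rho> * 2 ^ i)"
    have t: "\<rho> \<le> norm (x - z)" using that by (auto simp: dist_norm)
    obtain j where "norm (x - z) / \<rho> < 2 ^ j"
      using real_arch_pow[of 2 "norm (x - z) / \<rho>"] by auto
    then have "norm (x - z) < 2 ^ j * \<rho>" using that by (simp add: field_simps)
    then have "?P j" using mult_pos_pos[OF that(1) zero_less_power[of 2 j]] by (simp add: mult.commute)
    then have P: "?P (LEAST i. ?P i)" by (rule LeastI)
    show ?thesis
    proof (cases "LEAST i. ?P i")
      case 0
      then show ?thesis using P t by (intro exI[of _ 0]) auto
    next
      case (Suc i)
      then have "\<not> ?P i" using not_less_Least[of i ?P] by simp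
      then show ?thesis using P Suc by (intro exI[of _ "Suc i"]) auto
    qed
  qed
  show thesis
  proof (rule that)
    show "0 \<le> c" using q by (auto simp: c_def)
    fix x :: 'a and \<rho> :: real assume \<rho>: "0 < \<rho>"
    show "set_integrable lebesgue (- ball x \<rho>) (\<lambda>z. norm (x - z) powr s)"
      by (rule set_integrable_norm_powr_shells(1)[OF \<rho> _ q])
         (erule cover[OF \<rho>] | simp)+
    show "(LINT z:- ball x \<rho>|lebesgue. norm (x - z) powr s) \<le> c * \<rho> powr (DIM('a) + s)"
      unfolding c_def
      by (rule set_integrable_norm_powr_shells(2)[OF \<rho> _ q])
         (erule cover[OF \<rho>] | simp)+
  qed
qed

subsection \<open>Lebesgue-preserving reflections and lower semicontinuity\<close>

text \<open>An affine map that is diagonal with entries 1 or -1 has Jacobian of modulus 1. This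
  covers both the reflection in the hyperplane and the reflection in a point.\<close>

lemma
  fixes c :: "'a::euclidean_space \<Rightarrow> real" and t :: 'a
  assumes c: "\<And>j. j \<in> Basis \<Longrightarrow> \<bar>c j\<bar> = 1"
    and T: "\<And>x. T x = t + (\<Sum>j\<in>Basis. (c j * (x \<bullet> j)) *\<^sub>R j)"
  shows distr_lebesgue_signed_translation: "distr lebesgue lebesgue T = lebesgue"
    and measurable_lebesgue_signed_translation: "T \<in> lebesgue \<rightarrow>\<^sub>M lebesgue"
proof -
  have T': "T = (\<lambda>x. t + (\<Sum>j\<in>Basis. (c j * (x \<bullet> j)) *\<^sub>R j))" using T by blast
  have c0: "\<And>j. j \<in> Basis \<Longrightarrow> c j \<noteq> 0" using c by force
  have "lebesgue = density (distr lebesgue lebesgue T) (\<lambda>_. (\<Prod>j\<in>Basis. \<bar>c j\<bar>))"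
    unfolding T' by (rule lebesgue_affine_euclidean[OF c0])
  then show "distr lebesgue lebesgue T = lebesgue"
    using c by (simp add: density_1)
  show "T \<in> lebesgue \<rightarrow>\<^sub>M lebesgue"
    unfolding T' by (rule lebesgue_affine_measurable[OF c0])
qed

lemma reflect_affine:
  fixes x :: "real ^ 'n"
  shows "reflect k \<mu> x = (2 * \<mu>) *\<^sub>R axis k 1
    + (\<Sum>j\<in>Basis. ((if j = axis k 1 then -1 else 1) * (x \<bullet> j)) *\<^sub>R j)"
proof -
  have "(\<Sum>j\<in>Basis. ((if j = axis k 1 then -1 else 1) * (x \<bullet> j)) *\<^sub>R j)
      = (\<Sum>j\<in>Basis. (x \<bullet> j) *\<^sub>R j) - (\<Sum>j\<in>Basis. if j = axis k 1 then (2 * (x \<bullet> j)) *\<^sub>R j else 0)"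
    unfolding sum_subtractf[symmetric] by (rule sum.cong) (auto simp: scaleR_2 simp flip: scaleR_scaleR)
  also have "\<dots> = x - (2 * (x $ k)) *\<^sub>R axis k 1"
    by (simp add: euclidean_representation inner_axis axis_in_Basis_iff)
  finally show ?thesis
    by (simp add: reflect_def vec_eq_iff axis_def)
qed

lemma
  fixes k :: "'n::finite"
  shows distr_lebesgue_reflect: "distr lebesgue lebesgue (reflect k \<mu>) = lebesgue"
    and measurable_lebesgue_reflect: "reflect k \<mu> \<in> lebesgue \<rightarrow>\<^sub>M lebesgue"
  by (rule distr_lebesgue_signed_translation[OF _ reflect_affine], simp)
     (rule measurable_lebesgue_signed_translation[OF _ reflect_affine], simp)

lemma point_reflection_affine:
  fixes x z :: "'a::euclidean_space"
  shows "2 *\<^sub>R x - z = 2 *\<^sub>R x + (\<Sum>j\<in>Basis. (-1 * (z \<bullet> j)) *\<^sub>R j)"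
  by (simp add: sum_negf euclidean_representation)

lemma
  fixes f :: "'a::euclidean_space \<Rightarrow> real"
  assumes T: "distr lebesgue lebesgue T = lebesgue" "T \<in> lebesgue \<rightarrow>\<^sub>M lebesgue"
    and f: "f \<in> borel_measurable lebesgue" and A: "A \<in> sets lebesgue"
  shows set_integrable_measure_preserving:
      "set_integrable lebesgue A f \<longleftrightarrow> set_integrable lebesgue (T -` A) (\<lambda>z. f (T z))"
    and set_integral_measure_preserving:
      "(LINT z:A|lebesgue. f z) = (LINT z:T -` A|lebesgue. f (T z))"
proof -
  have m: "(\<lambda>z. indicator A z *\<^sub>R f z) \<in> borel_measurable lebesgue"
    using f A by simp
  have i: "indicator A (T z) = (indicator (T -` A) z :: real)" for z
    by (auto split: split_indicator)
  show "set_integrable lebesgue A f \<longleftrightarrow> set_integrable lebesgue (T -` A) (\<lambda>z. f (T z))"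
    using integrable_distr_eq[OF T(2) m] by (simp add: set_integrable_def T(1) i)
  show "(LINT z:A|lebesgue. f z) = (LINT z:T -` A|lebesgue. f (T z))"
    using integral_distr[OF T(2) m] by (simp add: set_lebesgue_integral_def T(1) i)
qed

text \<open>The point reflection in \<open>x\<close> preserves both the measure and \<open>A\<close>
  and flips the sign of \<open>f\<close>, so the integral equals its own negative. This disposes of
  first-order terms on annuli about \<open>x\<close>.\<close>

lemma set_integral_odd:
  fixes f :: "'a::euclidean_space \<Rightarrow> real"
  assumes f: "f \<in> borel_measurable lebesgue" and A: "A \<in> sets lebesgue"
    and sym: "\<And>z. 2 *\<^sub>R x - z \<in> A \<longleftrightarrow> z \<in> A" "\<And>z. f (2 *\<^sub>R x - z) = - f z"
  shows "(LINT z:A|lebesgue. f z) = 0"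
proof -
  let ?T = "\<lambda>z. 2 *\<^sub>R x - z"
  have "(LINT z:A|lebesgue. f z) = (LINT z:?T -` A|lebesgue. f (?T z))"
    using f A
    by (intro set_integral_measure_preserving
        distr_lebesgue_signed_translation[OF _ point_reflection_affine]
        measurable_lebesgue_signed_translation[OF _ point_reflection_affine]) auto
  also have "?T -` A = A" using sym(1) by auto
  also have "(LINT z:A|lebesgue. f (?T z)) = - (LINT z:A|lebesgue. f z)"
    by (simp add: sym(2) set_lebesgue_integral_def)
  finally show ?thesis by simp
qed

section \<open>Lower semicontinuous functions on compact sets\<close>

lemma lower_semicontinuous_on_subset:
  assumes "lower_semicontinuous_on S f" "T \<subseteq> S"
  shows "lower_semicontinuous_on T f"
  unfolding lower_semicontinuous_on_def
proof (intro ballI allI impI)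
  fix x a assume "x \<in> T" "a < f x"
  then have "\<forall>\<^sub>F y in at x within S. a < f y"
    using assms unfolding lower_semicontinuous_on_def by blast
  then show "\<forall>\<^sub>F y in at x within T. a < f y"
    by (rule filter_leD[OF at_le[OF assms(2)]])
qed

lemma lower_semicontinuous_on_add_continuous:
  assumes "lower_semicontinuous_on S f" "continuous_on S g"
  shows "lower_semicontinuous_on S (\<lambda>x. f x + g x)"
  unfolding lower_semicontinuous_on_def
proof (intro ballI allI impI)
  fix x a assume x: "x \<in> S" and a: "a < f x + g x"
  define e where "e = (f x + g x - a) / 2"
  have e: "0 < e" using a by (simp add: e_def)
  have "\<forall>\<^sub>F y in at x within S. f x - e < f y"
    using assms(1) x e unfolding lower_semicontinuous_on_def by simp
  moreover have "\<forall>\<^sub>F y in at x within S. g x - e < g y"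
    using assms(2) x e by (intro order_tendstoD(1)[of g "g x"]) (auto simp: continuous_on)
  ultimately show "\<forall>\<^sub>F y in at x within S. a < f y + g y"
    by eventually_elim (simp add: e_def field_simps)
qed

text \<open>Otherwise each \<open>x\<close> has a point \<open>y x\<close> with a smaller value and
  a neighbourhood on which \<open>f\<close> stays above \<open>f (y x)\<close>. Among the finitely
  many \<open>y x\<close> belonging to a subcover, one with least value is itself covered, which
  yields a smaller value still.\<close>

lemma lower_semicontinuous_on_attains_inf:
  assumes K: "compact K" "K \<noteq> {}" and f: "lower_semicontinuous_on K f"
  shows "\<exists>x\<in>K. \<forall>y\<in>K. f x \<le> f y"
proof (rule ccontr)
  assume "\<not> ?thesis"
  then obtain y where y: "\<And>x. x \<in> K \<Longrightarrow> y x \<in> K \<and> f (y x) < f x" by (metis not_le)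
  have "\<exists>U. open U \<and> x \<in> U \<and> (\<forall>z\<in>U \<inter> K. f (y x) < f z)" if "x \<in> K" for x
  proof -
    have "\<forall>\<^sub>F z in at x within K. f (y x) < f z"
      using f y[OF that] that unfolding lower_semicontinuous_on_def by blast
    then obtain U where "open U" "x \<in> U" "\<forall>z\<in>U. z \<noteq> x \<longrightarrow> z \<in> K \<longrightarrow> f (y x) < f z"
      unfolding eventually_at_topological by blast
    then show ?thesis using y[OF that] by (intro exI[of _ U]) auto
  qed
  then obtain U where U: "\<And>x. x \<in> K \<Longrightarrow> open (U x) \<and> x \<in> U x \<and> (\<forall>z\<in>U x \<inter> K. f (y x) < f z)"
    by metis
  obtain D where D: "D \<subseteq> K" "finite D" "K \<subseteq> (\<Union>x\<in>D. U x)"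
    using compactE_image[OF K(1), of K U] U by blast
  then have "D \<noteq> {}" using K(2) by auto
  then obtain x where x: "x \<in> D" "\<And>z. z \<in> D \<Longrightarrow> f (y x) \<le> f (y z)"
    using ex_min_if_finite[of "(\<lambda>x. f (y x)) ` D"] D(2) by (auto simp: not_less)
  have "y x \<in> K" using x D y by blast
  then obtain z where "z \<in> D" "y x \<in> U z" using D by blast
  then have "f (y z) < f (y x)" using U D \<open>y x \<in> K\<close> by blast
  then show False using x(2)[OF \<open>z \<in> D\<close>] by simp
qed

subsection \<open>Existence of the principal value\<close>

lemma open_left_halfspace: "open (left_halfspace k \<mu>)"
  unfolding left_halfspace_def by (rule open_halfspace_component_lt_cart)

lemma reflect_vimage_left_halfspace: "reflect k \<mu> -` {z. \<mu> < z $ k} = left_halfspace k \<mu>"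
  by (auto simp: reflect_def left_halfspace_def)

lemma AE_component_neq: "AE z :: real ^ 'n in lebesgue. z $ k \<noteq> \<mu>"
proof -
  have "negligible {z :: real ^ 'n. z $ k = \<mu>}"
    by (simp add: cart_eq_inner_axis negligible_standard_hyperplane)
  then show ?thesis
    using AE_not_in[of "{z. z $ k = \<mu>}" lebesgue] by (simp add: negligible_iff_null_sets)
qed

lemma ball_subset_left_halfspace:
  assumes "\<epsilon> \<le> \<mu> - x $ k"
  shows "ball x \<epsilon> \<subseteq> left_halfspace k \<mu>"
proof
  fix z assume "z \<in> ball x \<epsilon>"
  then show "z \<in> left_halfspace k \<mu>"
    using component_le_norm_cart[of "z - x" k] assms
    by (auto simp: left_halfspace_def dist_norm norm_minus_commute)
qed

lemma norm_diff_reflect_ge: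
  assumes "x \<in> left_halfspace k \<mu>" "z \<in> left_halfspace k \<mu>"
  shows "\<mu> - x $ k \<le> norm (x - reflect k \<mu> z)"
  using component_le_norm_cart[of "x - reflect k \<mu> z" k] assms
  by (auto simp: left_halfspace_def reflect_def)

text \<open>The squared distances differ only in coordinate \<open>k\<close>, by
  \<open>4 * (\<mu> - x $ k) * (\<mu> - z $ k) > 0\<close>. This is the source of
  \<open>K' < K\<close>.\<close>

lemma norm_diff_less_norm_diff_reflect:
  assumes "x \<in> left_halfspace k \<mu>" "z \<in> left_halfspace k \<mu>"
  shows "norm (x - z) < norm (x - reflect k \<mu> z)"
proof -
  have "(x $ i - z $ i)\<^sup>2 \<le> (x $ i - reflect k \<mu> z $ i)\<^sup>2
      \<and> (i = k \<longrightarrow> (x $ i - z $ i)\<^sup>2 < (x $ i - reflect k \<mu> z $ i)\<^sup>2)" for i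
  proof (cases "i = k")
    case True
    have "(x $ k - (2 * \<mu> - z $ k))\<^sup>2 - (x $ k - z $ k)\<^sup>2 = 4 * (\<mu> - x $ k) * (\<mu> - z $ k)"
      by (simp add: power2_eq_square algebra_simps)
    moreover have "0 < 4 * (\<mu> - x $ k) * (\<mu> - z $ k)"
      using assms by (simp add: left_halfspace_def)
    ultimately show ?thesis using True by (simp add: reflect_def)
  qed (simp add: reflect_def)
  then have "(\<Sum>i\<in>UNIV. (x $ i - z $ i)\<^sup>2) < (\<Sum>i\<in>UNIV. (x $ i - reflect k \<mu> z $ i)\<^sup>2)"
    by (intro sum_strict_mono_ex1) auto
  then show ?thesis
    by (simp add: norm_vec_def L2_set_def)
qed

lemma norm_reflect_diff: "norm (reflect k \<mu> x - reflect k \<mu> z) = norm (x - z)"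
proof -
  have "norm (reflect k \<mu> x $ i - reflect k \<mu> z $ i) = norm (x $ i - z $ i)" for i
    by (simp add: reflect_def abs_minus_commute)
  then show ?thesis by (simp add: norm_vec_def)
qed

section \<open>Integrability at infinity and second-order behaviour at the point\<close>

lemma borel_measurable_quotient_norm_powr:
  fixes x :: "'a::euclidean_space"
  assumes "f \<in> borel_measurable lebesgue"
  shows "(\<lambda>z. f z / norm (x - z) powr p) \<in> borel_measurable lebesgue"
proof -
  have "(\<lambda>z. norm (x - z) powr p) \<in> borel_measurable lebesgue"
    by (rule measurable_completion) measurable
  then show ?thesis using assms by measurable
qed

text \<open>Away from \<open>x\<close> the weight in \<open>L_space\<close> is dominated by a
  multiple of \<open>norm (x - z) powr p\<close>, where \<open>p\<close> is the exponent; this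
  handles the \<open>w\<close> part. The constant part is integrable because \<open>p\<close>
  exceeds the dimension.\<close>

lemma set_integrable_L_space_tail:
  fixes w :: "real ^ 'n \<Rightarrow> real" and x :: "real ^ 'n" and \<alpha> :: real
  assumes w: "w \<in> L_space \<alpha>" and \<alpha>: "0 < \<alpha>" and r: "0 < r"
  shows "set_integrable lebesgue (- ball x r) (\<lambda>z. (c - w z) / norm (x - z) powr (CARD('n) + \<alpha>))"
proof -
  let ?p = "CARD('n) + \<alpha>"
  \<comment> \<open>The first summand absorbs the 1 of the weight, using
    \<open>r \<le> norm (x - z)\<close>; the second comes from
    \<open>norm z \<le> (norm x / r + 1) * norm (x - z)\<close>.\<close>
  define D where "D = r powr - ?p + (norm x / r + 1) powr ?p"
  have p: "0 < ?p" using \<alpha> by (simp add: add_nonneg_pos)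
  have mw: "w \<in> borel_measurable lebesgue"
    and iw: "integrable lebesgue (\<lambda>z. \<bar>w z\<bar> / (1 + norm z powr ?p))"
    using w by (auto simp: L_space_def)
  have le: "1 + norm z powr ?p \<le> D * norm (x - z) powr ?p" if "z \<in> - ball x r" for z
  proof -
    have z: "r \<le> norm (x - z)" using that by (auto simp: dist_norm)
    have "norm z \<le> norm x + norm (x - z)"
      using norm_triangle_ineq4[of x "x - z"] by simp
    also have "norm x \<le> norm x / r * norm (x - z)"
      using mult_left_mono[OF z, of "norm x / r"] r by simp
    finally have "norm z \<le> (norm x / r + 1) * norm (x - z)" by (simp add: algebra_simps)
    then have "norm z powr ?p \<le> ((norm x / r + 1) * norm (x - z)) powr ?p"
      using p by (intro powr_mono2) auto
    also have "\<dots> = (norm x / r + 1) powr ?p * norm (x - z) powr ?p"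
      by (rule powr_mult)
    finally have 1: "norm z powr ?p \<le> (norm x / r + 1) powr ?p * norm (x - z) powr ?p" .
    have "1 = r powr - ?p * r powr ?p" using r by (simp flip: powr_add)
    also have "\<dots> \<le> r powr - ?p * norm (x - z) powr ?p"
      using z r p by (intro mult_left_mono powr_mono2) auto
    finally show ?thesis using 1 by (simp add: D_def algebra_simps)
  qed
  have "set_integrable lebesgue UNIV (\<lambda>z. \<bar>w z\<bar> / (1 + norm z powr ?p))"
    using iw by (simp add: set_integrable_def)
  then have "set_integrable lebesgue (- ball x r) (\<lambda>z. D * (\<bar>w z\<bar> / (1 + norm z powr ?p)))"
    by (intro set_integrable_mult_right) (rule set_integrable_subset, auto)
  then have w_int: "set_integrable lebesgue (- ball x r) (\<lambda>z. w z / norm (x - z) powr ?p)"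
  proof (rule set_integrable_bound)
    show "set_borel_measurable lebesgue (- ball x r) (\<lambda>z. w z / norm (x - z) powr ?p)"
      using borel_measurable_quotient_norm_powr[OF mw]
      unfolding set_borel_measurable_def by (intro borel_measurable_scaleR borel_measurable_indicator) auto
    show "AE z in lebesgue. z \<in> - ball x r \<longrightarrow>
        norm (w z / norm (x - z) powr ?p) \<le> norm (D * (\<bar>w z\<bar> / (1 + norm z powr ?p)))"
    proof (intro AE_I2 impI)
      fix z assume z: "z \<in> - ball x r"
      then have pos: "0 < norm (x - z) powr ?p" using r by (auto simp: dist_norm)
      have pos': "0 < 1 + norm z powr ?p" by (simp add: add_pos_nonneg)
      have "\<bar>w z\<bar> * (1 + norm z powr ?p) \<le> \<bar>w z\<bar> * (D * norm (x - z) powr ?p)"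
        using le[OF z] by (intro mult_left_mono) auto
      then have "\<bar>w z\<bar> / norm (x - z) powr ?p \<le> D * (\<bar>w z\<bar> / (1 + norm z powr ?p))"
        using pos pos' by (simp add: field_simps)
      also have "\<dots> \<le> norm (D * (\<bar>w z\<bar> / (1 + norm z powr ?p)))"
        unfolding real_norm_def by (rule abs_ge_self)
      finally show "norm (w z / norm (x - z) powr ?p) \<le> norm (D * (\<bar>w z\<bar> / (1 + norm z powr ?p)))"
        by simp
    qed
  qed
  have "- ?p < - real DIM(real ^ 'n)" using \<alpha> by simp
  then obtain C' where "\<And>(x::real ^ 'n) \<rho>. 0 < \<rho> \<Longrightarrow>
      set_integrable lebesgue (- ball x \<rho>) (\<lambda>z. norm (x - z) powr - ?p)"
    using integral_norm_powr_outside_ball by metis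
  then have "set_integrable lebesgue (- ball x r) (\<lambda>z. c * norm (x - z) powr - ?p)"
    using r by (intro set_integrable_mult_right) auto
  from set_integral_diff(1)[OF this w_int] show ?thesis
    by (simp add: powr_minus_divide diff_divide_distrib del: minus_add_distrib)
qed

text \<open>Mean value inequality for \<open>w\<close> minus its linearization, on the closed ball
  of radius \<open>norm (x - z)\<close>: there the gradient differs from that at \<open>x\<close> by
  at most \<open>L * norm (x - z)\<close>.\<close>

lemma C11_loc_quadratic_approximation:
  fixes w :: "'a::euclidean_space \<Rightarrow> real"
  assumes \<Omega>: "open \<Omega>" and w: "w \<in> C11_loc \<Omega>" and x: "x \<in> \<Omega>"
  shows "\<exists>g L. \<exists>r>0. 0 \<le> L \<and> (\<forall>z\<in>ball x r. \<bar>w z - w x - (z - x) \<bullet> g\<bar> \<le> L * (norm (x - z))\<^sup>2)"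
proof -
  obtain g where g: "\<And>x. x \<in> \<Omega> \<Longrightarrow> GDERIV w x :> g x"
    and lip: "\<forall>x\<in>\<Omega>. \<exists>r>0. \<exists>L. L-lipschitz_on (cball x r \<inter> \<Omega>) g"
    using w by (auto simp: C11_loc_def)
  obtain r1 L where r1: "0 < r1" and L: "L-lipschitz_on (cball x r1 \<inter> \<Omega>) g" using lip x by blast
  obtain r2 where r2: "0 < r2" "ball x r2 \<subseteq> \<Omega>" using \<Omega> x open_contains_ball by blast
  show ?thesis
  proof (intro exI conjI ballI)
    show "0 < min r1 r2" using r1 r2 by simp
    show "0 \<le> L" using L by (rule lipschitz_on_nonneg)
    fix z assume z: "z \<in> ball x (min r1 r2)"
    let ?S = "cball x (norm (x - z))"
    have S: "?S \<subseteq> cball x r1 \<inter> \<Omega>" using z r2(2) by (auto simp: dist_norm)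
    have "norm (w z - w x - (z - x) \<bullet> g x) \<le> norm (z - x) * (L * norm (x - z))"
    proof (rule differentiable_bound_linearization[where f' = "\<lambda>y h. h \<bullet> g y"])
      fix t :: real assume "t \<in> {0..1}"
      then show "x + t *\<^sub>R (z - x) \<in> ?S"
        by (auto simp: dist_norm norm_minus_commute[of z] mult_left_le_one_le)
    next
      fix y assume "y \<in> ?S"
      then show "(w has_derivative (\<lambda>h. h \<bullet> g y)) (at y within ?S)"
        using g S unfolding gderiv_def by (blast intro: has_derivative_at_withinI)
    next
      fix y assume y: "y \<in> ?S"
      show "onorm ((\<lambda>h. h \<bullet> g y) - (\<lambda>h. h \<bullet> g x)) \<le> L * norm (x - z)"
      proof (rule onorm_le)
        fix h :: 'a
        have "norm (g y - g x) \<le> L * dist y x"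
          using lipschitz_onD[OF L, of y x] subsetD[OF S y] x r1 by (simp add: dist_norm)
        also have "\<dots> \<le> L * norm (x - z)"
          using y lipschitz_on_nonneg[OF L] by (intro mult_left_mono) (auto simp: dist_commute)
        finally have "norm (g y - g x) \<le> L * norm (x - z)" .
        then have "norm h * norm (g y - g x) \<le> norm h * (L * norm (x - z))"
          by (intro mult_left_mono) auto
        then show "norm (((\<lambda>h. h \<bullet> g y) - (\<lambda>h. h \<bullet> g x)) h) \<le> L * norm (x - z) * norm h"
          using Cauchy_Schwarz_ineq2[of h "g y - g x"] by (simp add: inner_diff_right mult_ac)
      qed
    qed simp
    then show "\<bar>w z - w x - (z - x) \<bullet> g x\<bar> \<le> L * (norm (x - z))\<^sup>2"
      by (simp add: power2_eq_square norm_minus_commute mult_ac)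
  qed
qed

text \<open>Adding the linear term \<open>q\<close> to the integrand \<open>f\<close> leaves
  \<open>h\<close> of size \<open>norm (x - z) powr (2 - p)\<close>, which is integrable at
  \<open>x\<close> since \<open>\<alpha> < 2\<close>; and \<open>q\<close> is odd about
  \<open>x\<close>, so it contributes nothing to the truncated integral near
  \<open>x\<close>.\<close>

lemma principal_value_tendsto:
  fixes w :: "real ^ 'n \<Rightarrow> real" and x :: "real ^ 'n" and \<alpha> :: real
  assumes w: "w \<in> L_space \<alpha>" "w \<in> C11_loc \<Omega>" and \<Omega>: "open \<Omega>" "x \<in> \<Omega>"
    and \<alpha>: "0 < \<alpha>" "\<alpha> < 2"
  obtains l where "((\<lambda>\<epsilon>. LINT z:(UNIV - ball x \<epsilon>)|lebesgue.
      (w x - w z) / norm (x - z) powr (CARD('n) + \<alpha>)) \<longlongrightarrow> l) (at_right 0)"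
proof -
  let ?p = "CARD('n) + \<alpha>"
  define f where "f z = (w x - w z) / norm (x - z) powr ?p" for z
  obtain g L r where r: "0 < r" and L: "0 \<le> L"
    and approx: "\<forall>z\<in>ball x r. \<bar>w z - w x - (z - x) \<bullet> g\<bar> \<le> L * (norm (x - z))\<^sup>2"
    using C11_loc_quadratic_approximation[OF \<Omega>(1) w(2) \<Omega>(2)] by auto
  define q where "q z = (z - x) \<bullet> g / norm (x - z) powr ?p" for z
  define h where "h z = f z + q z" for z
  obtain C where C: "0 \<le> C"
    "\<And>\<rho>. 0 < \<rho> \<Longrightarrow> set_integrable lebesgue (ball x \<rho>) (\<lambda>z. norm (x - z) powr (2 - ?p))"
    "\<And>\<rho>. 0 < \<rho> \<Longrightarrow> (LINT z:ball x \<rho>|lebesgue. norm (x - z) powr (2 - ?p)) \<le> C * \<rho> powr (2 - \<alpha>)"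
  proof (rule integral_norm_powr_ball[where 'a = "real ^ 'n" and s = "2 - ?p"])
    show "- real DIM(real ^ 'n) < 2 - ?p" using \<alpha> by simp
  qed (use that in \<open>auto simp: algebra_simps\<close>)
  have mw: "w \<in> borel_measurable lebesgue" using w by (simp add: L_space_def)
  have mf: "f \<in> borel_measurable lebesgue"
    unfolding f_def[abs_def] using mw by (intro borel_measurable_quotient_norm_powr) measurable
  have mlin: "(\<lambda>z. (z - x) \<bullet> g) \<in> borel_measurable lebesgue"
    by (rule measurable_completion) measurable
  have mq: "q \<in> borel_measurable lebesgue"
    unfolding q_def[abs_def] by (rule borel_measurable_quotient_norm_powr[OF mlin])
  have mh: "h \<in> borel_measurable lebesgue"
    unfolding h_def[abs_def] using mf mq by measurable
  have hb: "\<bar>h z\<bar> \<le> L * norm (x - z) powr (2 - ?p)" if z: "z \<in> ball x r" for z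
  proof (cases "z = x")
    case False
    have "h z = - ((w z - w x - (z - x) \<bullet> g) / norm (x - z) powr ?p)"
      by (simp add: h_def f_def q_def diff_divide_distrib add_divide_distrib)
    also have "\<bar>\<dots>\<bar> \<le> L * (norm (x - z))\<^sup>2 / norm (x - z) powr ?p"
      using bspec[OF approx z] by (simp add: abs_div_pos divide_right_mono)
    also have "\<dots> = L * norm (x - z) powr (2 - ?p)"
      using False by (simp add: powr_diff)
    finally show ?thesis .
  qed (simp add: h_def f_def q_def)
  have h_int: "set_integrable lebesgue (ball x \<rho>) h" if "0 < \<rho>" "\<rho> \<le> r" for \<rho>
  proof (rule set_integrable_bound)
    show "set_integrable lebesgue (ball x \<rho>) (\<lambda>z. L * norm (x - z) powr (2 - ?p))"
      using C(2) that by (intro set_integrable_mult_right) auto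
    show "set_borel_measurable lebesgue (ball x \<rho>) h"
      using mh unfolding set_borel_measurable_def
      by (intro borel_measurable_scaleR borel_measurable_indicator) auto
    show "AE z in lebesgue. z \<in> ball x \<rho> \<longrightarrow> norm (h z) \<le> norm (L * norm (x - z) powr (2 - ?p))"
    proof (intro AE_I2 impI)
      fix z assume "z \<in> ball x \<rho>"
      then have "z \<in> ball x r" using that by auto
      then show "norm (h z) \<le> norm (L * norm (x - z) powr (2 - ?p))" using hb[of z] L by simp
    qed
  qed
  have h_small: "\<bar>LINT z:ball x \<rho>|lebesgue. h z\<bar> \<le> L * C * \<rho> powr (2 - \<alpha>)"
    if \<rho>: "0 < \<rho>" "\<rho> \<le> r" for \<rho>
  proof -
    have "\<bar>LINT z:ball x \<rho>|lebesgue. h z\<bar> \<le> (LINT z:ball x \<rho>|lebesgue. \<bar>h z\<bar>)"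
      using set_integral_norm_bound[OF h_int[OF \<rho>]] by simp
    also have "\<dots> \<le> (LINT z:ball x \<rho>|lebesgue. L * norm (x - z) powr (2 - ?p))"
      using h_int[OF \<rho>] C(2) \<rho> hb
      by (intro set_integral_mono set_integrable_abs set_integrable_mult_right) auto
    also have "\<dots> \<le> L * (C * \<rho> powr (2 - \<alpha>))"
      using C(3)[OF \<rho>(1)] L by (simp add: mult_left_mono)
    finally show ?thesis by simp
  qed
  have f_int: "set_integrable lebesgue (- ball x \<rho>) f" if "0 < \<rho>" for \<rho>
    unfolding f_def[abs_def] by (rule set_integrable_L_space_tail[OF w(1) \<alpha>(1) that])
  let ?a = "(LINT z:- ball x r|lebesgue. f z) + (LINT z:ball x r|lebesgue. h z)"
  \<comment> \<open>On the annulus between \<open>\<epsilon>\<close> and \<open>r\<close> the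
    integrals of \<open>f\<close> and \<open>h\<close> agree, because that of \<open>q\<close>
    vanishes. Only the integral of \<open>h\<close> extends down to \<open>x\<close>, so the
    dependence on \<open>\<epsilon>\<close> is isolated in a term that tends to 0.\<close>
  have F: "(LINT z:(UNIV - ball x \<epsilon>)|lebesgue. f z) = ?a - (LINT z:ball x \<epsilon>|lebesgue. h z)"
    if \<epsilon>: "0 < \<epsilon>" "\<epsilon> < r" for \<epsilon>
  proof -
    let ?A = "ball x r - ball x \<epsilon>"
    have fA: "set_integrable lebesgue ?A f"
      by (rule set_integrable_subset[OF f_int[OF \<epsilon>(1)]]) auto
    have hA: "set_integrable lebesgue ?A h"
      by (rule set_integrable_subset[OF h_int[OF r]]) auto
    have qA: "(LINT z:?A|lebesgue. q z) = 0"
    proof (rule set_integral_odd[OF mq, where x = x])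
      fix z
      have "x - (2 *\<^sub>R x - z) = - (x - z)" by (simp add: scaleR_2)
      then have n: "norm (x - (2 *\<^sub>R x - z)) = norm (x - z)" by (simp only: norm_minus_cancel)
      then show "2 *\<^sub>R x - z \<in> ?A \<longleftrightarrow> z \<in> ?A" by (simp add: dist_norm)
      have "2 *\<^sub>R x - z - x = - (z - x)" by (simp add: scaleR_2)
      then show "q (2 *\<^sub>R x - z) = - q z"
        unfolding q_def n by (simp only: inner_minus_left minus_divide_left)
    qed auto
    have "UNIV - ball x \<epsilon> = - ball x r \<union> ?A" using \<epsilon> by auto
    then have "(LINT z:(UNIV - ball x \<epsilon>)|lebesgue. f z)
        = (LINT z:- ball x r|lebesgue. f z) + (LINT z:?A|lebesgue. f z)"
      using set_integral_Un[OF _ f_int[OF r] fA] by auto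
    also have "(LINT z:?A|lebesgue. f z) = (LINT z:?A|lebesgue. h z) - (LINT z:?A|lebesgue. q z)"
    proof -
      have q: "q z = h z - f z" for z by (simp add: h_def)
      show ?thesis unfolding q using set_integral_diff(2)[OF hA fA] by simp
    qed
    also have "(LINT z:?A|lebesgue. h z) = (LINT z:ball x r|lebesgue. h z) - (LINT z:ball x \<epsilon>|lebesgue. h z)"
    proof -
      have "ball x r = ball x \<epsilon> \<union> ?A" using \<epsilon> by auto
      then show ?thesis
        using set_integral_Un[of "ball x \<epsilon>" ?A lebesgue h] h_int[of \<epsilon>] hA \<epsilon> by auto
    qed
    finally show ?thesis using qA by simp
  qed
  have ev: "\<forall>\<^sub>F \<epsilon> in at_right 0. 0 < \<epsilon> \<and> \<epsilon> < r"
    using eventually_at_right_real[OF r] by eventually_elim auto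
  have pow0: "((\<lambda>\<epsilon>. L * C * \<epsilon> powr (2 - \<alpha>)) \<longlongrightarrow> 0) (at_right 0)"
  proof -
    have "((\<lambda>\<epsilon>::real. \<epsilon> powr (2 - \<alpha>)) \<longlongrightarrow> 0) (at_right 0)"
      using \<alpha> eventually_at_right_less[of 0]
      by (intro tendsto_zero_powrI[of _ _ _ "2 - \<alpha>"]) (auto elim: eventually_mono)
    from tendsto_mult_right_zero[OF this] show ?thesis .
  qed
  have "((\<lambda>\<epsilon>. LINT z:ball x \<epsilon>|lebesgue. h z) \<longlongrightarrow> 0) (at_right 0)"
    using pow0 by (rule Lim_null_comparison[rotated]) (use ev in eventually_elim, simp add: h_small)
  then have "((\<lambda>\<epsilon>. ?a - (LINT z:ball x \<epsilon>|lebesgue. h z)) \<longlongrightarrow> ?a - 0) (at_right 0)"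
    by (intro tendsto_diff tendsto_const)
  then have "((\<lambda>\<epsilon>. LINT z:(UNIV - ball x \<epsilon>)|lebesgue. f z) \<longlongrightarrow> ?a - 0) (at_right 0)"
    by (rule Lim_transform_eventually) (use ev in eventually_elim, simp add: F)
  then show thesis using that unfolding f_def by blast
qed

subsection \<open>Folding onto the half-space\<close>

lemma set_integrable_const_ball:
  fixes x :: "'a::euclidean_space" and c :: real
  shows "set_integrable lebesgue (ball x r) (\<lambda>_. c)"
  using lmeasurable_ball[of x r] unfolding set_integrable_def fmeasurable_def
  by (intro integrable_scaleR_left integrable_real_indicator) auto

lemma norm_diff_reflect_pos:
  assumes "x \<in> left_halfspace k \<mu>" "z \<in> left_halfspace k \<mu>"
  shows "0 < norm (x - reflect k \<mu> z)"
  using assms(1) by (intro less_le_trans[OF _ norm_diff_reflect_ge[OF assms]]) (simp add: left_halfspace_def)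

locale antisymmetric_function =
  fixes \<alpha> \<mu> p :: real and k :: "'n::finite" and w :: "real ^ 'n \<Rightarrow> real"
  assumes \<alpha>: "0 < \<alpha>" "\<alpha> < 2" and p_eq: "p = CARD('n) + \<alpha>" and w: "w \<in> L_space \<alpha>"
    and anti: "\<And>z. z \<in> left_halfspace k \<mu> \<Longrightarrow> w (reflect k \<mu> z) = - w z"
begin

abbreviation "\<Sigma> \<equiv> left_halfspace k \<mu>"

text \<open>The sum of the principal value integrand at \<open>z\<close> and at the mirror image of
  \<open>z\<close>, with the value of \<open>w\<close> at the mirror image replaced by
  \<open>- w z\<close>.\<close>

definition folded_integrand :: "real ^ 'n \<Rightarrow> real ^ 'n \<Rightarrow> real" where
  "folded_integrand x z = (w x - w z) / norm (x - z) powr p + (w x + w z) / norm (x - reflect k \<mu> z) powr p"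

lemma borel_measurable_w: "w \<in> borel_measurable lebesgue"
  using w by (simp add: L_space_def)

lemma borel_measurable_difference_quotient:
  "(\<lambda>z. (w x - w z) / norm (x - z) powr p) \<in> borel_measurable lebesgue"
  using borel_measurable_w by (intro borel_measurable_quotient_norm_powr) measurable

text \<open>The far half-space avoids the ball of radius \<open>\<mu> - x $ k\<close> about
  \<open>x\<close>, so tail integrability applies there; the reflection carries the integral over to
  \<open>\<Sigma>\<close>, and antisymmetry turns \<open>w x - w z\<close> into
  \<open>w x + w z\<close>.\<close>

lemma
  assumes x: "x \<in> \<Sigma>"
  shows set_integrable_reflected: "set_integrable lebesgue \<Sigma> (\<lambda>z. (w x + w z) / norm (x - reflect k \<mu> z) powr p)"
    and set_integral_reflected: "(LINT z:{z. \<mu> < z $ k}|lebesgue. (w x - w z) / norm (x - z) powr p)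
      = (LINT z:\<Sigma>|lebesgue. (w x + w z) / norm (x - reflect k \<mu> z) powr p)"
proof -
  let ?f = "\<lambda>z. (w x - w z) / norm (x - z) powr p"
  let ?A = "{z. \<mu> < z $ k} :: (real ^ 'n) set"
  have A: "?A \<in> sets lebesgue" using open_halfspace_component_gt_cart[of \<mu> k] by simp
  have eq: "?f (reflect k \<mu> z) = (w x + w z) / norm (x - reflect k \<mu> z) powr p" if "z \<in> \<Sigma>" for z
    using anti[OF that] by simp
  have "?A \<subseteq> - ball x (\<mu> - x $ k)"
    using ball_subset_left_halfspace[of "\<mu> - x $ k" \<mu> x k] by (auto simp: left_halfspace_def)
  then have "set_integrable lebesgue ?A ?f"
    using x A by (intro set_integrable_subset[OF set_integrable_L_space_tail[OF w \<alpha>(1), folded p_eq, of "\<mu> - x $ k"]])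
      (auto simp: left_halfspace_def)
  moreover have "set_integrable lebesgue ?A ?f \<longleftrightarrow> set_integrable lebesgue \<Sigma> (\<lambda>z. ?f (reflect k \<mu> z))"
    using set_integrable_measure_preserving[OF distr_lebesgue_reflect[of k \<mu>]
        measurable_lebesgue_reflect borel_measurable_difference_quotient[of x] A]
    unfolding reflect_vimage_left_halfspace .
  ultimately have "set_integrable lebesgue \<Sigma> (\<lambda>z. ?f (reflect k \<mu> z))" by blast
  then show "set_integrable lebesgue \<Sigma> (\<lambda>z. (w x + w z) / norm (x - reflect k \<mu> z) powr p)"
    by (rule set_integrable_cong[THEN iffD1, rotated -1]) (auto simp: eq)
  have "(LINT z:?A|lebesgue. ?f z) = (LINT z:\<Sigma>|lebesgue. ?f (reflect k \<mu> z))"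
    using set_integral_measure_preserving[OF distr_lebesgue_reflect[of k \<mu>]
        measurable_lebesgue_reflect borel_measurable_difference_quotient[of x] A]
    unfolding reflect_vimage_left_halfspace .
  also have "\<dots> = (LINT z:\<Sigma>|lebesgue. (w x + w z) / norm (x - reflect k \<mu> z) powr p)"
    using open_left_halfspace[of k \<mu>] by (intro set_lebesgue_integral_cong) (auto simp: eq)
  finally show "(LINT z:?A|lebesgue. ?f z) = (LINT z:\<Sigma>|lebesgue. (w x + w z) / norm (x - reflect k \<mu> z) powr p)" .
qed

lemma set_integrable_folded:
  assumes x: "x \<in> \<Sigma>" and \<epsilon>: "0 < \<epsilon>"
  shows "set_integrable lebesgue (\<Sigma> - ball x \<epsilon>) (folded_integrand x)"
proof -
  have m: "\<Sigma> - ball x \<epsilon> \<in> sets lebesgue" using open_left_halfspace[of k \<mu>] by auto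
  have "set_integrable lebesgue (\<Sigma> - ball x \<epsilon>) (\<lambda>z. (w x - w z) / norm (x - z) powr p)"
    by (rule set_integrable_subset[OF set_integrable_L_space_tail[OF w \<alpha>(1), folded p_eq, OF \<epsilon>] m]) auto
  moreover have "set_integrable lebesgue (\<Sigma> - ball x \<epsilon>) (\<lambda>z. (w x + w z) / norm (x - reflect k \<mu> z) powr p)"
    by (rule set_integrable_subset[OF set_integrable_reflected[OF x] m]) auto
  ultimately show ?thesis
    unfolding folded_integrand_def[abs_def] by (rule set_integral_add)
qed

text \<open>The hole is cut only on the side of \<open>x\<close>, whereas the far half-space folds
  onto all of \<open>\<Sigma>\<close>. The reflected part over \<open>ball x \<epsilon>\<close>
  therefore remains as an error term.\<close>

lemma set_integral_folded:
  assumes x: "x \<in> \<Sigma>" and \<epsilon>: "0 < \<epsilon>" "\<epsilon> \<le> \<mu> - x $ k"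
  shows "(LINT z:(UNIV - ball x \<epsilon>)|lebesgue. (w x - w z) / norm (x - z) powr p)
    = (LINT z:(\<Sigma> - ball x \<epsilon>)|lebesgue. folded_integrand x z)
      + (LINT z:ball x \<epsilon>|lebesgue. (w x + w z) / norm (x - reflect k \<mu> z) powr p)"
proof -
  let ?f = "\<lambda>z. (w x - w z) / norm (x - z) powr p"
  let ?g = "\<lambda>z. (w x + w z) / norm (x - reflect k \<mu> z) powr p"
  let ?A = "{z. \<mu> < z $ k} :: (real ^ 'n) set"
  have sub: "ball x \<epsilon> \<subseteq> \<Sigma>" by (rule ball_subset_left_halfspace[OF \<epsilon>(2)])
  have sub': "z $ k < \<mu>" if "dist x z < \<epsilon>" for z using sub that by (auto simp: left_halfspace_def)
  have m: "\<Sigma> \<in> sets lebesgue" "\<Sigma> - ball x \<epsilon> \<in> sets lebesgue" "?A \<in> sets lebesgue"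
    using open_left_halfspace[of k \<mu>] open_halfspace_component_gt_cart[of \<mu> k] by auto
  have f: "set_integrable lebesgue (- ball x \<epsilon>) ?f"
    by (rule set_integrable_L_space_tail[OF w \<alpha>(1), folded p_eq, OF \<epsilon>(1)])
  have f1: "set_integrable lebesgue (\<Sigma> - ball x \<epsilon>) ?f"
    by (rule set_integrable_subset[OF f m(2)]) auto
  have f2: "set_integrable lebesgue ?A ?f"
    using sub by (intro set_integrable_subset[OF f m(3)]) (auto simp: left_halfspace_def)
  have g: "set_integrable lebesgue \<Sigma> ?g" by (rule set_integrable_reflected[OF x])
  have g1: "set_integrable lebesgue (\<Sigma> - ball x \<epsilon>) ?g"
    by (rule set_integrable_subset[OF g m(2)]) auto
  have g2: "set_integrable lebesgue (ball x \<epsilon>) ?g"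
    using sub by (intro set_integrable_subset[OF g]) auto
  \<comment> \<open>The two domains differ by the hyperplane, a null set.\<close>
  have "(LINT z:(UNIV - ball x \<epsilon>)|lebesgue. ?f z) = (LINT z:((\<Sigma> - ball x \<epsilon>) \<union> ?A)|lebesgue. ?f z)"
  proof (rule set_integral_cong_set)
    have b: "?f \<in> borel_measurable lebesgue" by (rule borel_measurable_difference_quotient)
    show "set_borel_measurable lebesgue (\<Sigma> - ball x \<epsilon> \<union> ?A) ?f"
      using b m unfolding set_borel_measurable_def
      by (intro borel_measurable_scaleR borel_measurable_indicator) auto
    show "set_borel_measurable lebesgue (UNIV - ball x \<epsilon>) ?f"
      using b unfolding set_borel_measurable_def
      by (intro borel_measurable_scaleR borel_measurable_indicator) auto
    show "AE z in lebesgue. (z \<in> \<Sigma> - ball x \<epsilon> \<union> ?A) = (z \<in> UNIV - ball x \<epsilon>)"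
      using AE_component_neq[of k \<mu>]
      by eventually_elim (auto simp: left_halfspace_def dest: sub')
  qed
  also have "\<dots> = (LINT z:(\<Sigma> - ball x \<epsilon>)|lebesgue. ?f z) + (LINT z:?A|lebesgue. ?f z)"
    using f1 f2 by (intro set_integral_Un) (auto simp: left_halfspace_def)
  also have "(LINT z:?A|lebesgue. ?f z) = (LINT z:\<Sigma>|lebesgue. ?g z)"
    by (rule set_integral_reflected[OF x])
  also have "(LINT z:\<Sigma>|lebesgue. ?g z)
      = (LINT z:(\<Sigma> - ball x \<epsilon>)|lebesgue. ?g z) + (LINT z:ball x \<epsilon>|lebesgue. ?g z)"
  proof -
    have "(\<Sigma> - ball x \<epsilon>) \<union> ball x \<epsilon> = \<Sigma>" using sub by blast
    then show ?thesis using set_integral_Un[OF _ g1 g2] by auto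
  qed
  finally show ?thesis
    using set_integral_add(2)[OF f1 g1] by (simp add: folded_integrand_def)
qed

text \<open>The reflected kernel is at most \<open>(\<mu> - x $ k) powr - p\<close>, continuity
  bounds \<open>w\<close> near \<open>x\<close>, and the volume of the ball tends to 0.\<close>

lemma reflected_ball_integral_tendsto_0:
  assumes x: "x \<in> \<Sigma>" and cont: "isCont w x"
  shows "((\<lambda>\<epsilon>. LINT z:ball x \<epsilon>|lebesgue. (w x + w z) / norm (x - reflect k \<mu> z) powr p) \<longlongrightarrow> 0) (at_right 0)"
proof -
  let ?g = "\<lambda>z. (w x + w z) / norm (x - reflect k \<mu> z) powr p"
  have p: "0 < p" using \<alpha> by (simp add: p_eq add_nonneg_pos)
  have d: "0 < \<mu> - x $ k" using x by (simp add: left_halfspace_def)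
  obtain r where r: "0 < r" "\<And>z. dist z x < r \<Longrightarrow> dist (w z) (w x) < 1"
    using cont[unfolded continuous_at_eps_delta] zero_less_one by blast
  define B where "B = (2 * \<bar>w x\<bar> + 1) / (\<mu> - x $ k) powr p"
  define r' where "r' = min r (\<mu> - x $ k)"
  have r': "0 < r'" using r d by (simp add: r'_def)
  have bound: "\<bar>LINT z:ball x \<epsilon>|lebesgue. ?g z\<bar> \<le> B * (unit_ball_vol (real CARD('n)) * \<epsilon> ^ CARD('n))"
    if \<epsilon>: "0 < \<epsilon>" "\<epsilon> < r'" for \<epsilon>
  proof -
    have sub: "ball x \<epsilon> \<subseteq> \<Sigma>" using \<epsilon> by (intro ball_subset_left_halfspace) (simp add: r'_def)
    have g: "set_integrable lebesgue (ball x \<epsilon>) ?g"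
      using sub by (intro set_integrable_subset[OF set_integrable_reflected[OF x]]) auto
    have "\<bar>LINT z:ball x \<epsilon>|lebesgue. ?g z\<bar> \<le> (LINT z:ball x \<epsilon>|lebesgue. \<bar>?g z\<bar>)"
      using set_integral_norm_bound[OF g] by simp
    also have "\<dots> \<le> (LINT z:ball x \<epsilon>|lebesgue. B)"
    proof (rule set_integral_mono[OF set_integrable_abs[OF g] set_integrable_const_ball])
      fix z assume z: "z \<in> ball x \<epsilon>"
      have "\<bar>w x + w z\<bar> \<le> 2 * \<bar>w x\<bar> + 1"
        using r(2)[of z] z \<epsilon> by (auto simp: dist_real_def r'_def dist_commute)
      moreover have "(\<mu> - x $ k) powr p \<le> norm (x - reflect k \<mu> z) powr p"
        using norm_diff_reflect_ge[OF x, of z] z sub d p by (intro powr_mono2) auto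
      ultimately show "\<bar>?g z\<bar> \<le> B"
        using d unfolding B_def by (simp add: frac_le)
    qed
    also have "\<dots> = B * (unit_ball_vol (real CARD('n)) * \<epsilon> ^ CARD('n))"
      using \<epsilon> content_ball[of \<epsilon> x] emeasure_lborel_ball_finite[of x \<epsilon>] by (subst set_integral_const) auto
    finally show ?thesis .
  qed
  have lim: "((\<lambda>\<epsilon>. B * (unit_ball_vol (real CARD('n)) * \<epsilon> ^ CARD('n))) \<longlongrightarrow> 0) (at_right 0)"
    by (rule tendsto_eq_intros refl | simp)+
  have ev: "\<forall>\<^sub>F \<epsilon> in at_right 0. \<epsilon> \<in> {0<..<r'}" by (rule eventually_at_right_real[OF r'])
  show ?thesis
    using lim by (rule Lim_null_comparison[rotated]) (use ev in eventually_elim, use bound in simp)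
qed

text \<open>Convergence of the principal value makes the total operator \<open>Lim\<close> return
  the actual limit, which the vanishing error term does not change. From here on only the folded
  integral is needed.\<close>

lemma frac_laplacian_folded:
  assumes x: "x \<in> \<Sigma>" "x \<in> \<Omega>" and \<Omega>: "open \<Omega>" "w \<in> C11_loc \<Omega>"
  obtains l where "frac_laplacian C \<alpha> w x = C * l"
    and "((\<lambda>\<epsilon>. LINT z:(\<Sigma> - ball x \<epsilon>)|lebesgue. folded_integrand x z) \<longlongrightarrow> l) (at_right 0)"
proof -
  let ?F = "\<lambda>\<epsilon>. LINT z:(UNIV - ball x \<epsilon>)|lebesgue. (w x - w z) / norm (x - z) powr p"
  let ?E = "\<lambda>\<epsilon>. LINT z:ball x \<epsilon>|lebesgue. (w x + w z) / norm (x - reflect k \<mu> z) powr p"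
  obtain l where l: "(?F \<longlongrightarrow> l) (at_right 0)"
    by (rule principal_value_tendsto[OF w \<Omega>(2,1) x(2) \<alpha>, folded p_eq])
  have "\<exists>g. GDERIV w x :> g" using \<Omega>(2) x(2) by (auto simp: C11_loc_def)
  then have "isCont w x" unfolding gderiv_def by (blast intro: has_derivative_continuous)
  then have E: "(?E \<longlongrightarrow> 0) (at_right 0)" by (rule reflected_ball_integral_tendsto_0[OF x(1)])
  have d: "0 < \<mu> - x $ k" using x by (simp add: left_halfspace_def)
  have ev: "\<forall>\<^sub>F \<epsilon> in at_right 0. \<epsilon> \<in> {0<..<\<mu> - x $ k}" by (rule eventually_at_right_real[OF d])
  have "((\<lambda>\<epsilon>. ?F \<epsilon> - ?E \<epsilon>) \<longlongrightarrow> l - 0) (at_right 0)" by (rule tendsto_diff[OF l E])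
  then have "((\<lambda>\<epsilon>. LINT z:(\<Sigma> - ball x \<epsilon>)|lebesgue. folded_integrand x z) \<longlongrightarrow> l - 0) (at_right 0)"
    by (rule Lim_transform_eventually) (use ev in eventually_elim, use set_integral_folded[OF x(1)] in simp)
  moreover have "frac_laplacian C \<alpha> w x = C * l"
    unfolding frac_laplacian_def p_eq[symmetric] using tendsto_Lim[OF _ l] by simp
  ultimately show thesis using that[of l] by simp
qed

end

subsection \<open>The sign of the folded integral\<close>

lemma norm_diff_reflect_self: "norm (x - reflect k \<mu> x) = 2 * \<bar>\<mu> - x $ k\<bar>"
proof -
  have "x - reflect k \<mu> x = (2 * (x $ k - \<mu>)) *\<^sub>R axis k 1"
    by (simp add: vec_eq_iff reflect_def axis_def)
  then show ?thesis by (auto simp: abs_if)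
qed

lemma reflect_reflect: "reflect k \<mu> (reflect k \<mu> z) = z"
  by (simp add: reflect_def vec_eq_iff)

context antisymmetric_function
begin

text \<open>The form in which signs are visible: the bracket is positive on \<open>\<Sigma>\<close>
  away from \<open>x\<close>, and the last term has the sign of \<open>w x\<close>.\<close>

lemma folded_integrand_eq:
  "folded_integrand x z = (w x - w z) * (1 / norm (x - z) powr p - 1 / norm (x - reflect k \<mu> z) powr p)
    + 2 * w x * (1 / norm (x - reflect k \<mu> z) powr p)"
  unfolding folded_integrand_def
  by (simp add: diff_divide_distrib add_divide_distrib right_diff_distrib left_diff_distrib)

lemma p_pos: "0 < p"
  using \<alpha> by (simp add: p_eq add_nonneg_pos)

lemma kernel_reflect_less:
  assumes "x \<in> \<Sigma>" "z \<in> \<Sigma>" "z \<noteq> x"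
  shows "1 / norm (x - reflect k \<mu> z) powr p < 1 / norm (x - z) powr p"
proof -
  have "norm (x - z) powr p < norm (x - reflect k \<mu> z) powr p"
    using norm_diff_less_norm_diff_reflect[OF assms(1,2)] p_pos by (intro powr_less_mono2) auto
  then show ?thesis
    using assms(3) norm_diff_reflect_pos[OF assms(1,2)] by (intro divide_strict_left_mono mult_pos_pos) auto
qed

text \<open>The integrand is nonpositive, so the truncated integrals decrease as the hole shrinks.
  Each is thus at least the limit \<open>l \<ge> 0\<close>, hence 0, and the strict inequality
  \<open>K' < K\<close> leaves only \<open>w z = 0\<close> almost everywhere.\<close>

lemma zero_if_nonneg_and_attained:
  assumes nonneg: "\<And>z. z \<in> \<Sigma> \<Longrightarrow> 0 \<le> w z" and x: "x \<in> \<Sigma>" "w x = 0" and l: "0 \<le> l"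
    and lim: "((\<lambda>\<epsilon>. LINT z:(\<Sigma> - ball x \<epsilon>)|lebesgue. folded_integrand x z) \<longlongrightarrow> l) (at_right 0)"
  shows "AE z in lebesgue. w z = 0"
proof -
  let ?J = "\<lambda>\<epsilon>. LINT z:(\<Sigma> - ball x \<epsilon>)|lebesgue. folded_integrand x z"
  have G: "folded_integrand x z = - w z * (1 / norm (x - z) powr p - 1 / norm (x - reflect k \<mu> z) powr p)" for z
    using x(2) by (simp add: folded_integrand_eq)
  have G_le: "folded_integrand x z \<le> 0" if "z \<in> \<Sigma>" "z \<noteq> x" for z
    using nonneg[OF that(1)] kernel_reflect_less[OF x(1) that] unfolding G
    by (intro mult_nonpos_nonneg) auto
  have m: "\<Sigma> - ball x \<epsilon> \<in> sets lebesgue" for \<epsilon> using open_left_halfspace[of k \<mu>] by auto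
  have AE_ball: "AE z in lebesgue. z \<in> \<Sigma> - ball x \<epsilon> \<longrightarrow> w z = 0" if \<epsilon>: "0 < \<epsilon>" for \<epsilon>
  proof -
    have ev: "\<forall>\<^sub>F \<delta> in at_right 0. \<delta> \<in> {0<..<\<epsilon>}" by (rule eventually_at_right_real[OF \<epsilon>])
    have "?J \<delta> \<le> ?J \<epsilon>" if \<delta>: "\<delta> \<in> {0<..<\<epsilon>}" for \<delta>
    proof -
      have i: "set_integrable lebesgue (\<Sigma> - ball x \<delta>) (folded_integrand x)"
        using set_integrable_folded[OF x(1)] \<delta> by auto
      show ?thesis
        unfolding set_lebesgue_integral_def
      proof (rule integral_mono)
        show "integrable lebesgue (\<lambda>z. indicator (\<Sigma> - ball x \<delta>) z *\<^sub>R folded_integrand x z)"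
          "integrable lebesgue (\<lambda>z. indicator (\<Sigma> - ball x \<epsilon>) z *\<^sub>R folded_integrand x z)"
          using i set_integrable_folded[OF x(1) \<epsilon>] by (auto simp: set_integrable_def)
        show "indicator (\<Sigma> - ball x \<delta>) z *\<^sub>R folded_integrand x z
            \<le> indicator (\<Sigma> - ball x \<epsilon>) z *\<^sub>R folded_integrand x z" for z
          using G_le[of z] \<delta> by (cases "z = x") (auto split: split_indicator)
      qed
    qed
    then have "l \<le> ?J \<epsilon>"
      by (intro tendsto_upperbound[OF lim] eventually_mono[OF ev]) auto
    then have J: "0 \<le> ?J \<epsilon>" using l by simp
    let ?H = "\<lambda>z. - (indicator (\<Sigma> - ball x \<epsilon>) z *\<^sub>R folded_integrand x z)"
    have iH: "integrable lebesgue ?H"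
      using set_integrable_folded[OF x(1) \<epsilon>] by (simp add: set_integrable_def)
    have pos: "0 \<le> ?H z" for z
      using G_le[of z] \<epsilon> by (cases "z = x") (auto split: split_indicator)
    have "integral\<^sup>L lebesgue ?H = - ?J \<epsilon>"
      by (simp add: set_lebesgue_integral_def)
    then have "integral\<^sup>L lebesgue ?H = 0"
      using J Bochner_Integration.integral_nonneg[of lebesgue ?H] pos by simp
    then have "AE z in lebesgue. ?H z = 0"
      using integral_nonneg_eq_0_iff_AE[OF iH] pos by simp
    then show ?thesis
    proof eventually_elim
      case (elim z)
      show ?case
      proof
        assume z: "z \<in> \<Sigma> - ball x \<epsilon>"
        then have "folded_integrand x z = 0" "z \<noteq> x" using elim \<epsilon> by auto
        then show "w z = 0" using kernel_reflect_less[OF x(1), of z] z unfolding G by auto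
      qed
    qed
  qed
  \<comment> \<open>Countably many radii exhaust \<open>\<Sigma>\<close> without the point
    \<open>x\<close>.\<close>
  have "AE z in lebesgue. \<forall>n. z \<in> \<Sigma> - ball x (1 / real (Suc n)) \<longrightarrow> w z = 0"
    unfolding AE_all_countable using AE_ball by simp
  moreover have "AE z in lebesgue. z \<noteq> x"
    using AE_not_in[of "{x}" lebesgue] negligible_sing[of x] by (simp add: negligible_iff_null_sets)
  ultimately have half: "AE z in lebesgue. z \<in> \<Sigma> \<longrightarrow> w z = 0"
  proof eventually_elim
    case (elim z)
    then have "0 < dist x z" by simp
    then obtain n where "1 / real (Suc n) < dist x z"
      using nat_approx_posE by blast
    then have "z \<notin> ball x (1 / real (Suc n))" by simp
    then show ?case using elim by blast
  qed
  \<comment> \<open>The reflection preserves null sets, so the statement transfers to the other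
    half-space.\<close>
  then have "AE z in lebesgue. reflect k \<mu> z \<in> \<Sigma> \<longrightarrow> w (reflect k \<mu> z) = 0"
    by (intro AE_distrD[OF measurable_lebesgue_reflect[of k \<mu>], of "\<lambda>z. z \<in> \<Sigma> \<longrightarrow> w z = 0"])
      (simp only: distr_lebesgue_reflect)
  with half AE_component_neq[of k \<mu>] show ?thesis
  proof eventually_elim
    case (elim z)
    show ?case
    proof (cases "z $ k < \<mu>")
      case True
      then show ?thesis using elim(1) by (simp add: left_halfspace_def)
    next
      case False
      then have r: "reflect k \<mu> z \<in> \<Sigma>" using elim(2) by (simp add: left_halfspace_def reflect_def)
      then show ?thesis using anti[OF r] elim(3) by (simp add: reflect_reflect)
    qed
  qed
qed

section \<open>Negativity of the folded integral at an approximate minimum\<close>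

text \<open>The paraboloid increment splits into a part odd about \<open>x\<close> and
  \<open>norm (x - z)\<close> squared. Only \<open>K\<close> is symmetric about \<open>x\<close>, so
  the odd part is kept with \<open>K\<close>, where it will integrate to 0; its product with
  \<open>K'\<close> is estimated crudely and merged with \<open>2 * w x * K'\<close>.\<close>

lemma folded_integrand_le_near:
  assumes x: "x \<in> \<Sigma>" and \<rho>: "0 < \<rho>" "\<mu> - x $ k \<le> 3 * \<rho>" "norm (x - y) \<le> \<rho>"
    and \<eta>: "0 < \<eta>" "4 * \<eta> < 2 * m"
    and wx: "w x \<le> - m + \<eta>"
    and z: "z \<in> \<Sigma>" "z \<in> ball x \<rho>" "z \<noteq> x"
    and touch: "w x - w z \<le> \<eta> / \<rho>\<^sup>2 * ((norm (z - y))\<^sup>2 - (norm (x - y))\<^sup>2)"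
  shows "folded_integrand x z \<le> \<eta> / \<rho>\<^sup>2 * (2 * ((z - x) \<bullet> (x - y))) / norm (x - z) powr p
    + \<eta> / \<rho>\<^sup>2 * norm (x - z) powr (2 - p) - (2 * m - 4 * \<eta>) * (7 * \<rho>) powr - p"
proof -
  let ?K = "1 / norm (x - z) powr p" and ?K' = "1 / norm (x - reflect k \<mu> z) powr p"
  let ?i = "(z - x) \<bullet> (x - y)"
  let ?Q = "\<eta> / \<rho>\<^sup>2 * (2 * ?i + (norm (x - z))\<^sup>2)"
  have zr: "norm (x - z) < \<rho>" using z by (simp add: dist_norm)
  have "z - y = (z - x) + (x - y)" by simp
  then have "(norm (z - y))\<^sup>2 = (norm (z - x))\<^sup>2 + 2 * ?i + (norm (x - y))\<^sup>2"
    by (simp only: power2_norm_eq_inner) (simp add: inner_diff_left inner_diff_right inner_commute algebra_simps)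
  then have a: "w x - w z \<le> ?Q" using touch by (simp add: norm_minus_commute add.commute)
  have "\<bar>?i\<bar> \<le> norm (z - x) * norm (x - y)" by (rule Cauchy_Schwarz_ineq2)
  also have "\<dots> \<le> \<rho> * \<rho>"
    using zr \<rho> by (intro mult_mono) (auto simp: norm_minus_commute)
  finally have "- 2 * \<rho>\<^sup>2 \<le> 2 * ?i + (norm (x - z))\<^sup>2"
    using zero_le_power2[of "norm (x - z)"] unfolding power2_eq_square by linarith
  then have "\<eta> / \<rho>\<^sup>2 * (- 2 * \<rho>\<^sup>2) \<le> ?Q" using \<eta> by (intro mult_left_mono) auto
  then have Q: "- 2 * \<eta> \<le> ?Q" using \<rho> by simp
  have K: "?K' \<le> ?K" using kernel_reflect_less[OF x z(1,3)] by simp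
  have pos: "0 < norm (x - reflect k \<mu> z)" by (rule norm_diff_reflect_pos[OF x z(1)])
  have "norm (x - reflect k \<mu> z) \<le> norm (x - reflect k \<mu> x) + norm (reflect k \<mu> x - reflect k \<mu> z)"
    using norm_triangle_ineq[of "x - reflect k \<mu> x" "reflect k \<mu> x - reflect k \<mu> z"] by simp
  \<comment> \<open>Twice the distance from \<open>x\<close> to the hyperplane, at most
    \<open>6 * \<rho>\<close>, plus \<open>norm (x - z) < \<rho>\<close>.\<close>
  also have "\<dots> \<le> 7 * \<rho>"
    using zr \<rho> x by (simp add: norm_diff_reflect_self norm_reflect_diff left_halfspace_def)
  finally have "(7 * \<rho>) powr - p \<le> norm (x - reflect k \<mu> z) powr - p"
    using pos p_pos by (intro powr_mono2') auto
  then have K': "(7 * \<rho>) powr - p \<le> ?K'" by (simp add: powr_minus_divide)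
  have "folded_integrand x z \<le> ?Q * (?K - ?K') + 2 * w x * ?K'"
    unfolding folded_integrand_eq using a K by (intro add_right_mono mult_right_mono) auto
  also have "\<dots> = ?Q * ?K + (2 * w x - ?Q) * ?K'" by (simp only: left_diff_distrib right_diff_distrib)
  \<comment> \<open>\<open>2 * w x \<le> - 2 * m + 2 * \<eta>\<close> and
    \<open>- ?Q \<le> 2 * \<eta>\<close>. The resulting coefficient is negative, so
    \<open>?K'\<close> may next be replaced by its lower bound.\<close>
  also have "\<dots> \<le> ?Q * ?K + (4 * \<eta> - 2 * m) * ?K'"
    using Q wx by (intro add_left_mono mult_right_mono) auto
  also have "\<dots> \<le> ?Q * ?K + (4 * \<eta> - 2 * m) * (7 * \<rho>) powr - p"
    using K' \<eta> by (intro add_left_mono mult_left_mono_neg) auto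
  also have "?Q * ?K = \<eta> / \<rho>\<^sup>2 * (2 * ?i) / norm (x - z) powr p + \<eta> / \<rho>\<^sup>2 * norm (x - z) powr (2 - p)"
    using z(3) by (simp add: powr_diff distrib_left add_divide_distrib)
  finally show ?thesis by (simp add: algebra_simps)
qed

text \<open>The term \<open>2 * w x * K'\<close> is nonpositive and is dropped, and
  \<open>K - K' \<le> K\<close>.\<close>

lemma folded_integrand_le_far:
  assumes x: "x \<in> \<Sigma>" and z: "z \<in> \<Sigma>" "z \<noteq> x" and \<eta>: "0 \<le> \<eta>" "w x \<le> 0" "w x - w z \<le> \<eta>"
  shows "folded_integrand x z \<le> \<eta> * norm (x - z) powr - p"
proof -
  let ?K = "1 / norm (x - z) powr p" and ?K' = "1 / norm (x - reflect k \<mu> z) powr p"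
  have "folded_integrand x z \<le> \<eta> * (?K - ?K') + 0"
    unfolding folded_integrand_eq using kernel_reflect_less[OF x z] \<eta>
    by (intro add_mono mult_right_mono) (auto simp: divide_nonpos_nonneg mult_nonpos_nonneg)
  also have "\<dots> \<le> \<eta> * ?K" using \<eta> by (simp add: algebra_simps)
  finally show ?thesis by (simp add: powr_minus_divide)
qed

text \<open>With \<open>\<eta> = \<theta> * m\<close>, the near and far bounds add up to
  \<open>\<rho> powr - \<alpha> * (\<eta> * (C1 + C2) - (2 * m - 4 * \<eta>) * c)\<close>. The
  bracket is linear in \<open>m\<close>, so one \<open>\<theta>\<close> serves all \<open>x\<close>,
  \<open>y\<close>, \<open>\<rho>\<close> and \<open>m\<close>.\<close>

lemma near_minimum_integral_negative:
  obtains \<theta> where "0 < \<theta>" "\<theta> < 1" and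
    "\<And>x y \<rho> m l. x \<in> \<Sigma> \<Longrightarrow> 0 < \<rho> \<Longrightarrow> \<rho> \<le> \<mu> - x $ k \<Longrightarrow> \<mu> - x $ k \<le> 3 * \<rho> \<Longrightarrow> norm (x - y) \<le> \<rho> \<Longrightarrow>
      0 < m \<Longrightarrow> w x \<le> - m + \<theta> * m \<Longrightarrow> (\<And>z. z \<in> \<Sigma> \<Longrightarrow> - m \<le> w z) \<Longrightarrow>
      (\<And>z. z \<in> \<Sigma> \<Longrightarrow> w x - w z \<le> \<theta> * m / \<rho>\<^sup>2 * ((norm (z - y))\<^sup>2 - (norm (x - y))\<^sup>2)) \<Longrightarrow>
      ((\<lambda>\<epsilon>. LINT z:(\<Sigma> - ball x \<epsilon>)|lebesgue. folded_integrand x z) \<longlongrightarrow> l) (at_right 0) \<Longrightarrow> l < 0"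
proof -
  let ?V = "unit_ball_vol (real CARD('n))"
  obtain C1 where C1: "0 \<le> C1"
    "\<And>(x::real ^ 'n) \<rho>. 0 < \<rho> \<Longrightarrow> set_integrable lebesgue (ball x \<rho>) (\<lambda>z. norm (x - z) powr (2 - p))"
    "\<And>(x::real ^ 'n) \<rho>. 0 < \<rho> \<Longrightarrow> (LINT z:ball x \<rho>|lebesgue. norm (x - z) powr (2 - p)) \<le> C1 * \<rho> powr (2 - \<alpha>)"
  proof (rule integral_norm_powr_ball[where 'a = "real ^ 'n" and s = "2 - p"])
    show "- real DIM(real ^ 'n) < 2 - p" using \<alpha> by (simp add: p_eq)
  qed (use that in \<open>auto simp: p_eq algebra_simps\<close>)
  obtain C2 where C2: "0 \<le> C2"
    "\<And>(x::real ^ 'n) \<rho>. 0 < \<rho> \<Longrightarrow> set_integrable lebesgue (- ball x \<rho>) (\<lambda>z. norm (x - z) powr - p)"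
    "\<And>(x::real ^ 'n) \<rho>. 0 < \<rho> \<Longrightarrow> (LINT z:- ball x \<rho>|lebesgue. norm (x - z) powr - p) \<le> C2 * \<rho> powr - \<alpha>"
  proof (rule integral_norm_powr_outside_ball[where 'a = "real ^ 'n" and s = "- p"])
    show "- p < - real DIM(real ^ 'n)" using \<alpha> by (simp add: p_eq)
  qed (use that in \<open>auto simp: p_eq algebra_simps\<close>)
  \<comment> \<open>The kernel bound \<open>(7 * \<rho>) powr - p\<close> times the volume of
    \<open>ball x \<rho>\<close> is \<open>c * \<rho> powr - \<alpha>\<close>.\<close>
  define c where "c = 7 powr - p * ?V"
  have c: "0 < c" by (simp add: c_def)
  \<comment> \<open>Solves \<open>\<theta> * (C1 + C2 + 4 * c) = c\<close>, which turns the final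
    bracket into \<open>- (m * c)\<close>.\<close>
  define \<theta> where "\<theta> = c / (C1 + C2 + 4 * c)"
  have \<theta>: "0 < \<theta>" "\<theta> < 1" "4 * \<theta> < 2" "\<theta> * (C1 + C2 + 4 * c) = c"
    using c C1(1) C2(1) by (auto simp: \<theta>_def field_simps)
  show thesis
  proof (rule that[OF \<theta>(1,2)])
    fix x y :: "real ^ 'n" and \<rho> m l :: real
    assume x: "x \<in> \<Sigma>" and \<rho>: "0 < \<rho>" "\<rho> \<le> \<mu> - x $ k" "\<mu> - x $ k \<le> 3 * \<rho>" "norm (x - y) \<le> \<rho>"
      and m: "0 < m" and wx: "w x \<le> - m + \<theta> * m" and wm: "\<And>z. z \<in> \<Sigma> \<Longrightarrow> - m \<le> w z"
      and touch: "\<And>z. z \<in> \<Sigma> \<Longrightarrow> w x - w z \<le> \<theta> * m / \<rho>\<^sup>2 * ((norm (z - y))\<^sup>2 - (norm (x - y))\<^sup>2)"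
      and lim: "((\<lambda>\<epsilon>. LINT z:(\<Sigma> - ball x \<epsilon>)|lebesgue. folded_integrand x z) \<longlongrightarrow> l) (at_right 0)"
    define \<eta> where "\<eta> = \<theta> * m"
    have \<eta>: "0 < \<eta>" "4 * \<eta> < 2 * m" "\<eta> < m" "\<eta> * (C1 + C2 + 4 * c) = m * c"
      using \<theta> m by (auto simp: \<eta>_def mult_ac)
    let ?S = "\<lambda>z. norm (x - z) powr (2 - p)" and ?T = "\<lambda>z. norm (x - z) powr - p"
    let ?q = "\<lambda>z. \<eta> / \<rho>\<^sup>2 * (2 * ((z - x) \<bullet> (x - y))) / norm (x - z) powr p"
    let ?b = "(2 * m - 4 * \<eta>) * (7 * \<rho>) powr - p"
    have sub: "ball x \<rho> \<subseteq> \<Sigma>" using \<rho> by (intro ball_subset_left_halfspace)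
    have mq: "?q \<in> borel_measurable lebesgue"
    proof (rule borel_measurable_quotient_norm_powr)
      show "(\<lambda>z. \<eta> / \<rho>\<^sup>2 * (2 * ((z - x) \<bullet> (x - y)))) \<in> borel_measurable lebesgue"
        by (rule measurable_completion) measurable
    qed
    have far: "(LINT z:(\<Sigma> - ball x \<rho>)|lebesgue. folded_integrand x z) \<le> \<eta> * (C2 * \<rho> powr - \<alpha>)"
    proof -
      have m': "\<Sigma> - ball x \<rho> \<in> sets lebesgue" using open_left_halfspace[of k \<mu>] by auto
      have T: "set_integrable lebesgue (\<Sigma> - ball x \<rho>) ?T"
        by (rule set_integrable_subset[OF C2(2)[OF \<rho>(1)] m']) auto
      have "(LINT z:(\<Sigma> - ball x \<rho>)|lebesgue. folded_integrand x z)
          \<le> (LINT z:(\<Sigma> - ball x \<rho>)|lebesgue. \<eta> * ?T z)"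
      proof (rule set_integral_mono)
        show "set_integrable lebesgue (\<Sigma> - ball x \<rho>) (folded_integrand x)"
          by (rule set_integrable_folded[OF x \<rho>(1)])
        show "set_integrable lebesgue (\<Sigma> - ball x \<rho>) (\<lambda>z. \<eta> * ?T z)"
          using T by (rule set_integrable_mult_right)
        fix z assume z: "z \<in> \<Sigma> - ball x \<rho>"
        show "folded_integrand x z \<le> \<eta> * ?T z"
          using z x \<rho> \<eta> wx wm[of z] by (intro folded_integrand_le_far) (auto simp: \<eta>_def[symmetric])
      qed
      also have "\<dots> = \<eta> * (LINT z:(\<Sigma> - ball x \<rho>)|lebesgue. ?T z)" by simp
      also have "(LINT z:(\<Sigma> - ball x \<rho>)|lebesgue. ?T z) \<le> (LINT z:- ball x \<rho>|lebesgue. ?T z)"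
        unfolding set_lebesgue_integral_def
      proof (rule integral_mono)
        show "integrable lebesgue (\<lambda>z. indicator (\<Sigma> - ball x \<rho>) z *\<^sub>R ?T z)"
          "integrable lebesgue (\<lambda>z. indicator (- ball x \<rho>) z *\<^sub>R ?T z)"
          using T C2(2)[OF \<rho>(1)] by (auto simp: set_integrable_def)
      qed (auto split: split_indicator)
      also have "\<dots> \<le> C2 * \<rho> powr - \<alpha>" by (rule C2(3)[OF \<rho>(1)])
      finally show ?thesis using \<eta>(1) by simp
    qed
    have near: "(LINT z:(ball x \<rho> - ball x \<epsilon>)|lebesgue. folded_integrand x z)
        \<le> \<eta> * (C1 * \<rho> powr - \<alpha>) - ?b * (?V * (\<rho> ^ CARD('n) - \<epsilon> ^ CARD('n)))"
      if \<epsilon>: "0 < \<epsilon>" "\<epsilon> < \<rho>" for \<epsilon>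
    proof -
      let ?A = "ball x \<rho> - ball x \<epsilon>"
      have G: "set_integrable lebesgue ?A (folded_integrand x)"
        using sub by (intro set_integrable_subset[OF set_integrable_folded[OF x \<epsilon>(1)]]) auto
      have S: "set_integrable lebesgue ?A (\<lambda>z. \<eta> / \<rho>\<^sup>2 * ?S z)"
        by (intro set_integrable_mult_right, rule set_integrable_subset[OF C1(2)[OF \<rho>(1)]]) auto
      have B: "set_integrable lebesgue ?A (\<lambda>_. ?b)"
        by (rule set_integrable_subset[OF set_integrable_const_ball[of x \<rho>]]) auto
      have q: "set_integrable lebesgue ?A ?q"
      proof (rule set_integrable_bound)
        let ?M = "\<eta> / \<rho>\<^sup>2 * (2 * (\<rho> * norm (x - y)))"
        show "set_integrable lebesgue ?A (\<lambda>z. ?M * ?T z)"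
          by (intro set_integrable_mult_right, rule set_integrable_subset[OF C2(2)[OF \<epsilon>(1)]]) auto
        show "set_borel_measurable lebesgue ?A ?q"
          using mq unfolding set_borel_measurable_def
          by (intro borel_measurable_scaleR borel_measurable_indicator) auto
        show "AE z in lebesgue. z \<in> ?A \<longrightarrow> norm (?q z) \<le> norm (?M * ?T z)"
        proof (intro AE_I2 impI)
          fix z assume z: "z \<in> ?A"
          have "\<bar>(z - x) \<bullet> (x - y)\<bar> \<le> norm (z - x) * norm (x - y)" by (rule Cauchy_Schwarz_ineq2)
          also have "\<dots> \<le> \<rho> * norm (x - y)"
            using z by (intro mult_right_mono) (auto simp: dist_norm norm_minus_commute)
          finally have i: "\<bar>(z - x) \<bullet> (x - y)\<bar> \<le> \<rho> * norm (x - y)" .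
          have "norm (?q z) = \<eta> / \<rho>\<^sup>2 * (2 * \<bar>(z - x) \<bullet> (x - y)\<bar>) * ?T z"
            using \<eta>(1) by (simp add: abs_mult powr_minus_divide)
          also have "\<dots> \<le> ?M * ?T z"
            using i \<eta>(1) by (intro mult_right_mono mult_left_mono) auto
          also have "\<dots> \<le> norm (?M * ?T z)" unfolding real_norm_def by (rule abs_ge_self)
          finally show "norm (?q z) \<le> norm (?M * ?T z)" .
        qed
      qed
      have q0: "(LINT z:?A|lebesgue. ?q z) = 0"
      proof (rule set_integral_odd[OF mq, where x = x])
        fix z
        have "x - (2 *\<^sub>R x - z) = - (x - z)" by (simp add: scaleR_2)
        then have n: "norm (x - (2 *\<^sub>R x - z)) = norm (x - z)" by (simp only: norm_minus_cancel)
        then show "2 *\<^sub>R x - z \<in> ?A \<longleftrightarrow> z \<in> ?A" by (simp add: dist_norm)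
        have "2 *\<^sub>R x - z - x = - (z - x)" by (simp add: scaleR_2)
        then show "?q (2 *\<^sub>R x - z) = - ?q z"
          unfolding n by (simp only: inner_minus_left minus_divide_left mult_minus_right)
      qed auto
      have "(LINT z:?A|lebesgue. folded_integrand x z)
          \<le> (LINT z:?A|lebesgue. ?q z + \<eta> / \<rho>\<^sup>2 * ?S z - ?b)"
      proof (rule set_integral_mono[OF G set_integral_diff(1)[OF set_integral_add(1)[OF q S] B]])
        fix z assume z: "z \<in> ?A"
        show "folded_integrand x z \<le> ?q z + \<eta> / \<rho>\<^sup>2 * ?S z - ?b"
          using z sub \<epsilon> x \<rho> \<eta> wx touch[of z]
          by (intro folded_integrand_le_near) (auto simp: \<eta>_def[symmetric])
      qed
      also have "\<dots> = \<eta> / \<rho>\<^sup>2 * (LINT z:?A|lebesgue. ?S z) - (LINT z:?A|lebesgue. ?b)"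
        using set_integral_diff(2)[OF set_integral_add(1)[OF q S] B] set_integral_add(2)[OF q S] q0 by simp
      also have "(LINT z:?A|lebesgue. ?b) = ?b * (?V * (\<rho> ^ CARD('n) - \<epsilon> ^ CARD('n)))"
      proof -
        have "ball x \<epsilon> \<union> ?A = ball x \<rho>" using \<epsilon> by auto
        then have "(LINT z:ball x \<rho>|lebesgue. ?b) = (LINT z:ball x \<epsilon>|lebesgue. ?b) + (LINT z:?A|lebesgue. ?b)"
          using set_integral_Un[OF _ set_integrable_const_ball[of x \<epsilon>] B] by auto
        moreover have "(LINT z:ball x s|lebesgue. ?b) = ?b * (?V * s ^ CARD('n))" if "0 < s" for s
          using that content_ball[of s x] emeasure_lborel_ball_finite[of x s] by (subst set_integral_const) auto
        ultimately have "(LINT z:?A|lebesgue. ?b) = ?b * (?V * \<rho> ^ CARD('n)) - ?b * (?V * \<epsilon> ^ CARD('n))"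
          using \<epsilon>(1) \<rho>(1) by (simp only: add_diff_cancel_left')
        then show ?thesis by (simp only: right_diff_distrib)
      qed
      also have "\<eta> / \<rho>\<^sup>2 * (LINT z:?A|lebesgue. ?S z) \<le> \<eta> * (C1 * \<rho> powr - \<alpha>)"
      proof -
        have "(LINT z:?A|lebesgue. ?S z) \<le> (LINT z:ball x \<rho>|lebesgue. ?S z)"
          unfolding set_lebesgue_integral_def
        proof (rule integral_mono)
          have "set_integrable lebesgue ?A ?S"
            by (rule set_integrable_subset[OF C1(2)[OF \<rho>(1)]]) auto
          then show "integrable lebesgue (\<lambda>z. indicator ?A z *\<^sub>R ?S z)"
            "integrable lebesgue (\<lambda>z. indicator (ball x \<rho>) z *\<^sub>R ?S z)"
            using C1(2)[OF \<rho>(1)] by (auto simp: set_integrable_def)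
        qed (auto split: split_indicator)
        also have "\<dots> \<le> C1 * \<rho> powr (2 - \<alpha>)" by (rule C1(3)[OF \<rho>(1)])
        finally have "\<eta> / \<rho>\<^sup>2 * (LINT z:?A|lebesgue. ?S z) \<le> \<eta> / \<rho>\<^sup>2 * (C1 * \<rho> powr (2 - \<alpha>))"
          using \<eta>(1) by (intro mult_left_mono) auto
        \<comment> \<open>The square cancels against the opening
          \<open>\<eta> / \<rho>\<^sup>2\<close> of the paraboloid, leaving the same power of
          \<open>\<rho>\<close> as the other two contributions.\<close>
        also have "\<rho> powr (2 - \<alpha>) = \<rho>\<^sup>2 * \<rho> powr - \<alpha>"
          using \<rho>(1) powr_add[of \<rho> 2 "- \<alpha>"] by simp
        finally show ?thesis using \<rho>(1) by simp
      qed
      finally show ?thesis by simp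
    qed
    have "((\<lambda>\<epsilon>. \<eta> * (C1 * \<rho> powr - \<alpha>) - ?b * (?V * (\<rho> ^ CARD('n) - \<epsilon> ^ CARD('n))) + \<eta> * (C2 * \<rho> powr - \<alpha>))
        \<longlongrightarrow> \<eta> * (C1 * \<rho> powr - \<alpha>) - ?b * (?V * (\<rho> ^ CARD('n) - 0 ^ CARD('n))) + \<eta> * (C2 * \<rho> powr - \<alpha>)) (at_right 0)"
      by (intro tendsto_intros)
    from this lim have "l \<le> \<eta> * (C1 * \<rho> powr - \<alpha>) - ?b * (?V * (\<rho> ^ CARD('n) - 0 ^ CARD('n))) + \<eta> * (C2 * \<rho> powr - \<alpha>)"
    proof (rule tendsto_le[OF trivial_limit_at_right_real])
      show "\<forall>\<^sub>F \<epsilon> in at_right 0. (LINT z:(\<Sigma> - ball x \<epsilon>)|lebesgue. folded_integrand x z)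
          \<le> \<eta> * (C1 * \<rho> powr - \<alpha>) - ?b * (?V * (\<rho> ^ CARD('n) - \<epsilon> ^ CARD('n))) + \<eta> * (C2 * \<rho> powr - \<alpha>)"
        using eventually_at_right_real[OF \<rho>(1)]
      proof eventually_elim
        case (elim \<epsilon>)
        then have \<epsilon>: "0 < \<epsilon>" "\<epsilon> < \<rho>" by auto
        have "(ball x \<rho> - ball x \<epsilon>) \<union> (\<Sigma> - ball x \<rho>) = \<Sigma> - ball x \<epsilon>" using sub \<epsilon> by auto
        moreover have "set_integrable lebesgue (ball x \<rho> - ball x \<epsilon>) (folded_integrand x)"
          using sub by (intro set_integrable_subset[OF set_integrable_folded[OF x \<epsilon>(1)]]) auto
        ultimately have "(LINT z:(\<Sigma> - ball x \<epsilon>)|lebesgue. folded_integrand x z)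
            = (LINT z:(ball x \<rho> - ball x \<epsilon>)|lebesgue. folded_integrand x z)
              + (LINT z:(\<Sigma> - ball x \<rho>)|lebesgue. folded_integrand x z)"
          using set_integral_Un[OF _ _ set_integrable_folded[OF x \<rho>(1)], of "ball x \<rho> - ball x \<epsilon>"] by auto
        then show ?case using near[OF \<epsilon>] far by linarith
      qed
    qed
    also have "\<dots> = \<rho> powr - \<alpha> * (\<eta> * (C1 + C2) - (2 * m - 4 * \<eta>) * c)"
    proof -
      have "\<rho> powr - p * \<rho> ^ CARD('n) = \<rho> powr - \<alpha>"
        using \<rho>(1) by (simp add: p_eq powr_realpow[symmetric] flip: powr_add)
      then have b: "?b * (?V * \<rho> ^ CARD('n)) = (2 * m - 4 * \<eta>) * c * \<rho> powr - \<alpha>"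
        unfolding c_def powr_mult by (simp add: mult_ac)
      have z: "(0::real) ^ CARD('n) = 0" by simp
      show ?thesis unfolding z diff_0_right b by (simp add: algebra_simps)
    qed
    also have "\<eta> * (C1 + C2) - (2 * m - 4 * \<eta>) * c = - (m * c)"
      using \<eta>(4) by (simp add: algebra_simps)
    also have "\<rho> powr - \<alpha> * - (m * c) < 0"
      using m c \<rho>(1) by (simp add: mult_pos_pos)
    finally show "l < 0" .
  qed
qed

section \<open>The maximum principle by touching with a paraboloid\<close>

text \<open>The bound \<open>-1\<close> far out serves to make the infimum finite. The perturbed
  minimum stays in \<open>\<Omega>\<close> and at a distance comparable to \<open>\<rho>\<close>
  from the hyperplane, where \<open>near_minimum_integral_negative\<close> contradicts the sign of
  the fractional Laplacian.\<close>

lemma nonneg_of_frac_laplacian_nonneg: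
  assumes \<Omega>: "open \<Omega>" "\<Omega> \<subseteq> \<Sigma>" and C11: "w \<in> C11_loc \<Omega>"
    and lsc: "lower_semicontinuous_on (closure \<Omega>) w"
    and C: "0 < C" and lap: "\<And>x. x \<in> \<Omega> \<Longrightarrow> 0 \<le> frac_laplacian C \<alpha> w x"
    and out: "\<And>x. x \<in> \<Sigma> - \<Omega> \<Longrightarrow> 0 \<le> w x"
    and far: "\<And>x. x \<in> \<Sigma> \<Longrightarrow> b \<le> norm x \<Longrightarrow> -1 \<le> w x"
  shows "x \<in> \<Sigma> \<Longrightarrow> 0 \<le> w x"
proof (rule ccontr)
  fix x' assume x': "x' \<in> \<Sigma>" "\<not> 0 \<le> w x'"
  obtain M where M: "\<And>z. z \<in> \<Sigma> \<Longrightarrow> M \<le> w z"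
  proof (cases "closure \<Omega> \<inter> cball 0 b = {}")
    case True
    then have "-1 \<le> w z" if "z \<in> \<Sigma>" for z
      using out[of z] far[of z] that closure_subset[of \<Omega>] by (cases "z \<in> \<Omega>") force+
    then show ?thesis using that by blast
  next
    case False
    have "compact (closure \<Omega> \<inter> cball 0 b)" by (intro closed_Int_compact) auto
    then obtain u where u: "\<forall>z\<in>closure \<Omega> \<inter> cball 0 b. w u \<le> w z"
      using lower_semicontinuous_on_attains_inf[OF _ False lower_semicontinuous_on_subset[OF lsc]] by auto
    have "min (w u) (-1) \<le> w z" if "z \<in> \<Sigma>" for z
    proof (cases "z \<in> \<Omega> \<and> norm z \<le> b")
      case True
      then have "z \<in> closure \<Omega> \<inter> cball 0 b" using closure_subset[of \<Omega>] by auto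
      then show ?thesis using u by force
    next
      case False
      then show ?thesis using out[of z] far[of z] that by force
    qed
    then show ?thesis using that by blast
  qed
  then have bdd: "bdd_below (w ` \<Sigma>)" by (rule bdd_belowI2)
  define m where "m = - Inf (w ` \<Sigma>)"
  have wm: "- m \<le> w z" if "z \<in> \<Sigma>" for z using cInf_lower[OF _ bdd] that by (simp add: m_def)
  have m: "0 < m" using wm[OF x'(1)] x'(2) by simp
  obtain \<theta> where \<theta>: "0 < \<theta>" "\<theta> < 1" and neg:
    "\<And>x y \<rho> m l. x \<in> \<Sigma> \<Longrightarrow> 0 < \<rho> \<Longrightarrow> \<rho> \<le> \<mu> - x $ k \<Longrightarrow> \<mu> - x $ k \<le> 3 * \<rho> \<Longrightarrow> norm (x - y) \<le> \<rho> \<Longrightarrow>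
      0 < m \<Longrightarrow> w x \<le> - m + \<theta> * m \<Longrightarrow> (\<And>z. z \<in> \<Sigma> \<Longrightarrow> - m \<le> w z) \<Longrightarrow>
      (\<And>z. z \<in> \<Sigma> \<Longrightarrow> w x - w z \<le> \<theta> * m / \<rho>\<^sup>2 * ((norm (z - y))\<^sup>2 - (norm (x - y))\<^sup>2)) \<Longrightarrow>
      ((\<lambda>\<epsilon>. LINT z:(\<Sigma> - ball x \<epsilon>)|lebesgue. folded_integrand x z) \<longlongrightarrow> l) (at_right 0) \<Longrightarrow> l < 0"
    by (rule near_minimum_integral_negative) blast
  have \<theta>m: "0 < \<theta> * m" "\<theta> * m < m" using \<theta> m by auto
  have "Inf (w ` \<Sigma>) < - m + \<theta> * m" using \<theta>m by (simp add: m_def)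
  then obtain y where y: "y \<in> \<Sigma>" "w y < - m + \<theta> * m"
    using cInf_lessD[of "w ` \<Sigma>"] x'(1) by blast
  have y\<Omega>: "y \<in> \<Omega>" using out[of y] y \<theta>m by force
  \<comment> \<open>Half the distance to the hyperplane, so every point of
    \<open>cball y \<rho>\<close> lies in \<open>\<Sigma>\<close> at a distance between
    \<open>\<rho>\<close> and \<open>3 * \<rho>\<close> from it.\<close>
  define \<rho> where "\<rho> = (\<mu> - y $ k) / 2"
  have \<rho>: "0 < \<rho>" using y(1) by (simp add: \<rho>_def left_halfspace_def)
  \<comment> \<open>At distance \<open>\<rho>\<close> from \<open>y\<close> the paraboloid has risen
    by \<open>\<theta> * m\<close>, more than the excess of \<open>w y\<close> over the
    infimum.\<close>
  let ?u = "\<lambda>z. w z + \<theta> * m / \<rho>\<^sup>2 * (norm (z - y))\<^sup>2"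
  let ?K = "closure \<Omega> \<inter> cball y \<rho>"
  have "compact ?K" by (intro closed_Int_compact) auto
  moreover have "y \<in> ?K" using y\<Omega> closure_subset[of \<Omega>] \<rho> by auto
  moreover have "lower_semicontinuous_on ?K ?u"
    by (intro lower_semicontinuous_on_add_continuous lower_semicontinuous_on_subset[OF lsc] continuous_intros) auto
  ultimately obtain x where x: "x \<in> ?K" "\<And>z. z \<in> ?K \<Longrightarrow> ?u x \<le> ?u z"
    using lower_semicontinuous_on_attains_inf[of ?K ?u] by blast
  have uy: "?u x < - m + \<theta> * m" using x(2)[OF \<open>y \<in> ?K\<close>] y(2) by simp
  have quad: "0 \<le> \<theta> * m / \<rho>\<^sup>2 * (norm (z - y))\<^sup>2" for z using \<theta>m by simp
  have xy: "norm (x - y) \<le> \<rho>" using x(1) by (simp add: dist_norm norm_minus_commute)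
  have xk: "\<bar>x $ k - y $ k\<bar> \<le> \<rho>" using component_le_norm_cart[of "x - y" k] xy by simp
  have "\<mu> - y $ k = 2 * \<rho>" by (simp add: \<rho>_def)
  with xk have x\<rho>: "\<rho> \<le> \<mu> - x $ k" "\<mu> - x $ k \<le> 3 * \<rho>" by linarith+
  have x\<Sigma>: "x \<in> \<Sigma>" using x\<rho> \<rho> by (simp add: left_halfspace_def)
  have wx: "w x < - m + \<theta> * m" using uy quad[of x] by linarith
  \<comment> \<open>A priori \<open>x\<close> could be a boundary point of \<open>\<Omega>\<close>;
    but it lies in \<open>\<Sigma>\<close>, and \<open>w\<close> is nonnegative on
    \<open>\<Sigma> - \<Omega>\<close>.\<close>
  have x\<Omega>: "x \<in> \<Omega>" using out[of x] x\<Sigma> wx \<theta>m by force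
  \<comment> \<open>The minimum over \<open>?K\<close> is global on \<open>\<Sigma>\<close>: off
    \<open>\<Omega>\<close> the values are nonnegative, and beyond distance \<open>\<rho>\<close>
    they are at least \<open>- m + \<theta> * m\<close>, while \<open>?u x\<close> lies below both
    bounds.\<close>
  have min: "?u x \<le> ?u z" if z: "z \<in> \<Sigma>" for z
  proof (cases "z \<in> \<Omega>")
    case False
    then have "0 \<le> w z" using out z by blast
    then show ?thesis using uy quad[of z] \<theta>m by linarith
  next
    case True
    show ?thesis
    proof (cases "norm (z - y) \<le> \<rho>")
      case True
      with \<open>z \<in> \<Omega>\<close> have "z \<in> ?K" using closure_subset[of \<Omega>] by (auto simp: dist_norm norm_minus_commute)
      then show ?thesis by (rule x(2))
    next
      case False
      have "\<theta> * m = \<theta> * m / \<rho>\<^sup>2 * \<rho>\<^sup>2" using \<rho> by simp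
      also have "\<dots> \<le> \<theta> * m / \<rho>\<^sup>2 * (norm (z - y))\<^sup>2"
        using False \<rho> \<theta>m by (intro mult_left_mono power_mono) auto
      finally show ?thesis using uy wm[OF z] by linarith
    qed
  qed
  obtain l where l: "frac_laplacian C \<alpha> w x = C * l"
    "((\<lambda>\<epsilon>. LINT z:(\<Sigma> - ball x \<epsilon>)|lebesgue. folded_integrand x z) \<longlongrightarrow> l) (at_right 0)"
    by (rule frac_laplacian_folded[OF x\<Sigma> x\<Omega> \<Omega>(1) C11])
  have "l < 0"
  proof (rule neg[OF x\<Sigma> \<rho> x\<rho> xy m less_imp_le[OF wx] wm _ l(2)])
    fix z assume "z \<in> \<Sigma>"
    from min[OF this] show "w x - w z \<le> \<theta> * m / \<rho>\<^sup>2 * ((norm (z - y))\<^sup>2 - (norm (x - y))\<^sup>2)"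
      by (simp add: right_diff_distrib)
  qed
  moreover have "0 \<le> l" using lap[OF x\<Omega>] C unfolding l(1) by (simp add: zero_le_mult_iff)
  ultimately show False by simp
qed

end

section \<open>Nonnegativity and the vanishing alternative for bounded and unbounded regions\<close>

theorem theorem1:
  fixes \<alpha> \<mu> C :: real and k :: "'n::finite"
    and \<Omega> :: "(real ^ 'n) set" and w :: "real ^ 'n \<Rightarrow> real"
  assumes "0 < \<alpha>" and "\<alpha> < 2" and "0 < C"
    and "open \<Omega>" and "connected \<Omega>" and "\<Omega> \<noteq> {}"
    and "\<Omega> \<subseteq> left_halfspace k \<mu>"
    and "w \<in> L_space \<alpha> \<inter> C11_loc \<Omega>"
    and "lower_semicontinuous_on (closure \<Omega>) w"
    and "\<And>x. x \<in> \<Omega> \<Longrightarrow> frac_laplacian C \<alpha> w x \<ge> 0"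
    and "\<And>x. x \<in> left_halfspace k \<mu> - \<Omega> \<Longrightarrow> w x \<ge> 0"
    and "\<And>x. x \<in> left_halfspace k \<mu> \<Longrightarrow> w (reflect k \<mu> x) = - w x"
    and "bounded \<Omega> \<or>
         0 \<le> Liminf (inf at_infinity (principal (left_halfspace k \<mu>))) (\<lambda>x. ereal (w x))"
  shows "(\<forall>x\<in>\<Omega>. w x \<ge> 0) \<and> ((\<exists>x\<in>\<Omega>. w x = 0) \<longrightarrow> (AE x in lebesgue. w x = 0))"
proof -
  interpret antisymmetric_function \<alpha> \<mu> "CARD('n) + \<alpha>" k w
    using assms(1,2,8,12) by unfold_locales auto
  \<comment> \<open>A common consequence of both alternatives: far out either all points of
    \<open>\<Sigma>\<close> are outside \<open>\<Omega>\<close>, where \<open>w\<close> is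
    nonnegative, or the limit inferior keeps \<open>w\<close> above \<open>-1\<close>.\<close>
  have far: "\<exists>b. \<forall>x\<in>\<Sigma>. b \<le> norm x \<longrightarrow> -1 \<le> w x"
    using assms(13)
  proof
    assume "bounded \<Omega>"
    then obtain b where b: "\<And>x. x \<in> \<Omega> \<Longrightarrow> norm x \<le> b" unfolding bounded_iff by blast
    have "-1 \<le> w x" if "x \<in> \<Sigma>" "b + 1 \<le> norm x" for x
      using b[of x] assms(11)[of x] that by force
    then show ?thesis by blast
  next
    assume "0 \<le> Liminf (inf at_infinity (principal \<Sigma>)) (\<lambda>x. ereal (w x))"
    then have "\<forall>\<^sub>F x in inf at_infinity (principal \<Sigma>). ereal (-1) < ereal (w x)"
      unfolding le_Liminf_iff by (metis ereal_less(5) ereal_less_eq(3) less_ereal.simps(1) neg_less_0_iff_less zero_ereal_def zero_less_one)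
    then show ?thesis
      unfolding eventually_inf_principal eventually_at_infinity by (auto intro: less_imp_le)
  qed
  then obtain b where b: "\<And>x. x \<in> \<Sigma> \<Longrightarrow> b \<le> norm x \<Longrightarrow> -1 \<le> w x" by blast
  have nonneg: "0 \<le> w x" if "x \<in> \<Sigma>" for x
    using nonneg_of_frac_laplacian_nonneg[OF assms(4,7) _ assms(9,3,10,11) b that] assms(8) by blast
  moreover have "AE x in lebesgue. w x = 0" if zero: "x \<in> \<Omega>" "w x = 0" for x
  proof -
    have x: "x \<in> \<Sigma>" using zero assms(7) by blast
    have C11: "w \<in> C11_loc \<Omega>" using assms(8) by blast
    obtain l where l: "frac_laplacian C \<alpha> w x = C * l"
      "((\<lambda>\<epsilon>. LINT z:(\<Sigma> - ball x \<epsilon>)|lebesgue. folded_integrand x z) \<longlongrightarrow> l) (at_right 0)"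
      by (rule frac_laplacian_folded[OF x zero(1) assms(4) C11])
    have "0 \<le> l" using assms(10)[OF zero(1)] assms(3) unfolding l(1) by (simp add: zero_le_mult_iff)
    show ?thesis by (rule zero_if_nonneg_and_attained[OF nonneg x zero(2) \<open>0 \<le> l\<close> l(2)])
  qed
  ultimately show ?thesis using assms(7) by blast
qed

end
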